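(* Let $\mathcal{T}$ be a skeletally small triangulated category and let $\mathcal{S}$ be a set of objects of $\mathcal{T}$ such that $\mathcal{T}=\mathrm{tria}_{\mathcal{T}}(\mathcal{S})$. Let $[\mathcal{S}]:=\{[S] : S\in\mathcal{S}\}$ denote the corresponding set of generators of the group $K_0(\mathcal{T})$, and let $\widehat{\mathcal{S}}$ be the subcategory of $\mathcal{T}$ consisting of the objects $X$ which are finite direct sums of shifts of objects in $\mathcal{S}$ and are such that $[X]=0$ in $K_0(\mathcal{T})$. Denote by $\mathcal{T}^0_{\Delta}$ (resp. $\mathcal{T}^0_{\Delta+\mathrm{nil}}$) the full subcategory of $\mathcal{T}$ consisting of the objects $X$ such that $0\leq_{\Delta}X$ (resp. $0\leq_{\Delta+\mathrm{nil}}X$), and by $\mathcal{T}^0$ the (triangulated) full subcategory of $\mathcal{T}$ consisting of the objects $M$ such that $[M]=0$ in $K_0(\mathcal{T})$. Then the following assertions hold: (1) An object $M$ is in $\mathcal{T}^0$ if, and only if, $M\leq_{\Delta}X$ (resp. $M\preceq_{\Delta+\mathrm{nil}}X$) for some $X\in\widehat{\mathcal{S}}$. When $[\mathcal{S}]$ is a basis of $K_0(\mathcal{T})$, the objects $X$ can be chosen to be finite direct sums of shifts of objects in $\bar{\mathcal{S}}:=\{S\oplus S[2k+1] : k\in\mathbb{Z},\ S\in\mathcal{S}\}$. (2) $\mathcal{T}^0=\mathrm{tria}_{\mathcal{T}}(S\oplus S[t_S] : S\in\mathcal{S})$ for every choice of odd integers $t_S$ ($S\in\mathcal{S}$). (3)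 $\mathcal{T}^0$ is the extension closure of $\mathcal{T}^0_{\Delta}$ (resp. of $\mathcal{T}^0_{\Delta+\mathrm{nil}}$).
   Context: $K_0(\mathcal{T})$ is the Grothendieck group of $\mathcal{T}$, and $[X]$ denotes the class of $X$ in it. For objects $M,N$ of $\mathcal{T}$ with shift $[1]$: $M\leq_{\Delta}N$ means that there are an object $Z$ and a distinguished triangle $Z\xrightarrow{\begin{pmatrix}v\\ u\end{pmatrix}}Z\oplus M\to N\to Z[1]$; $M\leq_{\Delta+\mathrm{nil}}N$ means that there is such a triangle with the endomorphism $v$ of $Z$ nilpotent. The relation $\preceq_{\Delta+\mathrm{nil}}$ is the smallest transitive relation (on isomorphism classes of objects of $\mathcal{T}$) containing $\leq_{\Delta+\mathrm{nil}}$. For a subcategory (or set of objects) $\mathcal{U}$ of $\mathcal{T}$, $\mathrm{tria}_{\mathcal{T}}(\mathcal{U})$ is the smallest triangulated subcategory of $\mathcal{T}$ containing $\mathcal{U}$. Its objects are precisely those $M$ admitting a sequence $0=M_0\xrightarrow{f_1}M_1\to\cdots\xrightarrow{f_n}M_n=M$ with $\mathrm{cone}(f_k)\cong U_k[r_k]$ for some $U_k\in\mathcal{U}$ and $r_k\in\mathbb{Z}$, for all $k$; no closure under direct summands is taken. For full subcategories $\mathcal{U},\mathcal{V}$, $\mathcal{U}\star\mathcal{V}$ is the full subcategory of the objects $M$ fitting in a distinguished triangle $U\to M\to V\to U[1]$ with $U\in\mathcal{U}$, $V\in\mathcal{V}$. This operation is associative. The extension closure of $\mathcal{U}$ is $\bigcup_{n\geq0}\mathcal{U}^{\star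 n}$, where $\mathcal{U}^{\star n}=\mathcal{U}\star\cdots\star\mathcal{U}$ ($n$ factors) and $\mathcal{U}^{\star0}=0$; it is the smallest full subcategory closed under extensions and containing $\mathcal{U}$. *)

theory Defs
  imports "HOL-Algebra.Free_Abelian_Groups" "HOL-Algebra.Generated_Groups"
begin

record ('o, 'm) cat =
  obj :: "'o set"
  mor :: "'m set"
  src :: "'m \<Rightarrow> 'o"
  tgt :: "'m \<Rightarrow> 'o"
  ident :: "'o \<Rightarrow> 'm"
  cmp :: "'m \<Rightarrow> 'm \<Rightarrow> 'm"  (infixl "\<cdot>\<index>" 70)

record ('o, 'm) addcat = "('o, 'm) cat" +
  hadd :: "'m \<Rightarrow> 'm \<Rightarrow> 'm"  (infixl "\<boxplus>\<index>" 65)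
  hzero :: "'o \<Rightarrow> 'o \<Rightarrow> 'm"

definition hom_set :: "('o, 'm, 'z) cat_scheme \<Rightarrow> 'o \<Rightarrow> 'o \<Rightarrow> 'm set" where
  "hom_set C X Y = {f \<in> mor C. src C f = X \<and> tgt C f = Y}"

locale category =
  fixes C (structure)
  assumes src_obj: "f \<in> mor C \<Longrightarrow> src C f \<in> obj C"
    and tgt_obj: "f \<in> mor C \<Longrightarrow> tgt C f \<in> obj C"
    and ident_hom: "X \<in> obj C \<Longrightarrow> ident C X \<in> hom_set C X X"
    and cmp_hom: "f \<in> hom_set C X Y \<Longrightarrow> g \<in> hom_set C Y Z \<Longrightarrow> g \<cdot> f \<in> hom_set C X Z"
    and ident_left: "f \<in> hom_set C X Y \<Longrightarrow> ident C Y \<cdot> f = f"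
    and ident_right: "f \<in> hom_set C X Y \<Longrightarrow> f \<cdot> ident C X = f"
    and cmp_assoc: "f \<in> hom_set C X Y \<Longrightarrow> g \<in> hom_set C Y Z \<Longrightarrow> h \<in> hom_set C Z W
        \<Longrightarrow> h \<cdot> (g \<cdot> f) = (h \<cdot> g) \<cdot> f"

definition is_isom :: "('o, 'm, 'z) cat_scheme \<Rightarrow> 'o \<Rightarrow> 'o \<Rightarrow> 'm \<Rightarrow> bool" where
  "is_isom C X Y f \<longleftrightarrow> f \<in> hom_set C X Y \<and>
     (\<exists>g \<in> hom_set C Y X. g \<cdot>\<^bsub>C\<^esub> f = ident C X \<and> f \<cdot>\<^bsub>C\<^esub> g = ident C Y)"

definition isomorphic :: "('o, 'm, 'z) cat_scheme \<Rightarrow> 'o \<Rightarrow> 'o \<Rightarrow> bool" where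
  "isomorphic C X Y \<longleftrightarrow> X \<in> obj C \<and> Y \<in> obj C \<and> (\<exists>f. is_isom C X Y f)"

definition is_zero_obj :: "('o, 'm, 'z) cat_scheme \<Rightarrow> 'o \<Rightarrow> bool" where
  "is_zero_obj C O' \<longleftrightarrow> O' \<in> obj C \<and>
     (\<forall>X \<in> obj C. (\<exists>!f. f \<in> hom_set C O' X) \<and> (\<exists>!f. f \<in> hom_set C X O'))"

definition hom_group :: "('o, 'm, 'z) addcat_scheme \<Rightarrow> 'o \<Rightarrow> 'o \<Rightarrow> 'm monoid" where
  "hom_group C X Y =
     \<lparr>carrier = hom_set C X Y, monoid.mult = hadd C, one = hzero C X Y\<rparr>"

definition hneg :: "('o, 'm, 'z) addcat_scheme \<Rightarrow> 'm \<Rightarrow> 'm" where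
  "hneg C f = inv\<^bsub>hom_group C (src C f) (tgt C f)\<^esub> f"

definition is_biproduct ::
  "('o, 'm, 'z) addcat_scheme \<Rightarrow> 'o \<Rightarrow> 'o \<Rightarrow> 'o \<Rightarrow> 'm \<Rightarrow> 'm \<Rightarrow> 'm \<Rightarrow> 'm \<Rightarrow> bool" where
  "is_biproduct C A B W i j p q \<longleftrightarrow>
     i \<in> hom_set C A W \<and> j \<in> hom_set C B W \<and> p \<in> hom_set C W A \<and> q \<in> hom_set C W B \<and>
     p \<cdot>\<^bsub>C\<^esub> i = ident C A \<and> q \<cdot>\<^bsub>C\<^esub> j = ident C B \<and>
     q \<cdot>\<^bsub>C\<^esub> i = hzero C A B \<and> p \<cdot>\<^bsub>C\<^esub> j = hzero C B A \<and>
     (i \<cdot>\<^bsub>C\<^esub> p) \<boxplus>\<^bsub>C\<^esub> (j \<cdot>\<^bsub>C\<^esub> q) = ident C W"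

text \<open>Direct sums are determined only up to isomorphism, so that ``\<open>W\<close> is \<open>A \<oplus> B\<close>'' is a
  relation; it is invariant under isomorphism in all three arguments.\<close>

definition is_dsum :: "('o, 'm, 'z) addcat_scheme \<Rightarrow> 'o \<Rightarrow> 'o \<Rightarrow> 'o \<Rightarrow> bool" where
  "is_dsum C A B W \<longleftrightarrow> A \<in> obj C \<and> B \<in> obj C \<and> W \<in> obj C \<and>
     (\<exists>i j p q. is_biproduct C A B W i j p q)"

locale additive_category = category C
  for C :: "('o, 'm, 'z) addcat_scheme" (structure) +
  assumes hom_comm_group: "X \<in> obj C \<Longrightarrow> Y \<in> obj C \<Longrightarrow> comm_group (hom_group C X Y)"
    and cmp_add_left: "f \<in> hom_set C X Y \<Longrightarrow> f' \<in> hom_set C X Y \<Longrightarrow> g \<in> hom_set C Y Z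
        \<Longrightarrow> g \<cdot> (f \<boxplus> f') = (g \<cdot> f) \<boxplus> (g \<cdot> f')"
    and cmp_add_right: "f \<in> hom_set C X Y \<Longrightarrow> g \<in> hom_set C Y Z \<Longrightarrow> g' \<in> hom_set C Y Z
        \<Longrightarrow> (g \<boxplus> g') \<cdot> f = (g \<cdot> f) \<boxplus> (g' \<cdot> f)"
    and zero_obj_exists: "\<exists>O'. is_zero_obj C O'"
    and dsum_exists: "A \<in> obj C \<Longrightarrow> B \<in> obj C \<Longrightarrow> \<exists>W. is_dsum C A B W"

inductive_set finite_dsums :: "('o, 'm, 'z) addcat_scheme \<Rightarrow> 'o set \<Rightarrow> 'o set"
  for C :: "('o, 'm, 'z) addcat_scheme" and U :: "'o set" where
  zero: "is_zero_obj C O' \<Longrightarrow> O' \<in> finite_dsums C U"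
| step: "A \<in> U \<Longrightarrow> B \<in> finite_dsums C U \<Longrightarrow> is_dsum C A B W \<Longrightarrow> W \<in> finite_dsums C U"

definition nilpotent_endo :: "('o, 'm, 'z) addcat_scheme \<Rightarrow> 'o \<Rightarrow> 'm \<Rightarrow> bool" where
  "nilpotent_endo C Z v \<longleftrightarrow> v \<in> hom_set C Z Z \<and>
     (\<exists>n. ((\<lambda>w. v \<cdot>\<^bsub>C\<^esub> w) ^^ n) (ident C Z) = hzero C Z Z)"

text \<open>A triangle \<open>X \<rightarrow> Y \<rightarrow> Z \<rightarrow> X[1]\<close> is recorded as the triple of its morphisms;
  the objects are recovered as sources and targets.\<close>

record ('o, 'm) tricat = "('o, 'm) addcat" +
  sobj :: "'o \<Rightarrow> 'o"
  smor :: "'m \<Rightarrow> 'm"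
  tri :: "('m \<times> 'm \<times> 'm) set"

definition dist_tri ::
  "('o, 'm, 'z) tricat_scheme \<Rightarrow> 'o \<Rightarrow> 'o \<Rightarrow> 'o \<Rightarrow> 'm \<Rightarrow> 'm \<Rightarrow> 'm \<Rightarrow> bool" where
  "dist_tri T X Y Z f g h \<longleftrightarrow> (f, g, h) \<in> tri T \<and>
     f \<in> hom_set T X Y \<and> g \<in> hom_set T Y Z \<and> h \<in> hom_set T Z (sobj T X)"

text \<open>The shift is an additive self-equivalence, not necessarily an automorphism.
  The octahedral axiom is included.\<close>

locale triangulated_category = additive_category T
  for T :: "('o, 'm, 'z) tricat_scheme" (structure) +
  assumes sobj_obj: "X \<in> obj T \<Longrightarrow> sobj T X \<in> obj T"
    and smor_bij: "X \<in> obj T \<Longrightarrow> Y \<in> obj T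
        \<Longrightarrow> bij_betw (smor T) (hom_set T X Y) (hom_set T (sobj T X) (sobj T Y))"
    and smor_ident: "X \<in> obj T \<Longrightarrow> smor T (ident T X) = ident T (sobj T X)"
    and smor_cmp: "f \<in> hom_set T X Y \<Longrightarrow> g \<in> hom_set T Y Z
        \<Longrightarrow> smor T (g \<cdot> f) = smor T g \<cdot> smor T f"
    and smor_add: "f \<in> hom_set T X Y \<Longrightarrow> f' \<in> hom_set T X Y
        \<Longrightarrow> smor T (f \<boxplus> f') = smor T f \<boxplus> smor T f'"
    and sobj_ess_surj: "Y \<in> obj T \<Longrightarrow> \<exists>X. X \<in> obj T \<and> isomorphic T (sobj T X) Y"
    and tri_typed: "(f, g, h) \<in> tri T \<Longrightarrow> \<exists>X Y Z. dist_tri T X Y Z f g h"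
    and tri_iso: "dist_tri T X Y Z f g h
        \<Longrightarrow> f' \<in> hom_set T X' Y' \<Longrightarrow> g' \<in> hom_set T Y' Z' \<Longrightarrow> h' \<in> hom_set T Z' (sobj T X')
        \<Longrightarrow> is_isom T X X' a \<Longrightarrow> is_isom T Y Y' b \<Longrightarrow> is_isom T Z Z' c
        \<Longrightarrow> b \<cdot> f = f' \<cdot> a \<Longrightarrow> c \<cdot> g = g' \<cdot> b \<Longrightarrow> smor T a \<cdot> h = h' \<cdot> c
        \<Longrightarrow> dist_tri T X' Y' Z' f' g' h'"
    and tri_ident: "X \<in> obj T \<Longrightarrow> is_zero_obj T O'
        \<Longrightarrow> dist_tri T X X O' (ident T X) (hzero T X O') (hzero T O' (sobj T X))"
    and tri_cone: "f \<in> hom_set T X Y \<Longrightarrow> \<exists>Z g h. dist_tri T X Y Z f g h"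
    and tri_rotate: "f \<in> hom_set T X Y \<Longrightarrow> g \<in> hom_set T Y Z \<Longrightarrow> h \<in> hom_set T Z (sobj T X)
        \<Longrightarrow> dist_tri T X Y Z f g h \<longleftrightarrow> dist_tri T Y Z (sobj T X) g h (hneg T (smor T f))"
    and tri_morphism: "dist_tri T X Y Z f g h \<Longrightarrow> dist_tri T X' Y' Z' f' g' h'
        \<Longrightarrow> a \<in> hom_set T X X' \<Longrightarrow> b \<in> hom_set T Y Y' \<Longrightarrow> b \<cdot> f = f' \<cdot> a
        \<Longrightarrow> \<exists>c \<in> hom_set T Z Z'. c \<cdot> g = g' \<cdot> b \<and> smor T a \<cdot> h = h' \<cdot> c"
    and tri_octahedral: "dist_tri T X Y U f a a' \<Longrightarrow> dist_tri T Y Z V g b b'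
        \<Longrightarrow> dist_tri T X Z W (g \<cdot> f) c c'
        \<Longrightarrow> \<exists>m n. dist_tri T U W V m n (smor T a \<cdot> b') \<and>
              m \<cdot> a = c \<cdot> g \<and> c' \<cdot> m = a' \<and> n \<cdot> c = b \<and> b' \<cdot> n = smor T f \<cdot> c'"

text \<open>Since the shift is only an equivalence, negative shifts are determined up to isomorphism
  and are chosen.\<close>

definition unshift :: "('o, 'm, 'z) tricat_scheme \<Rightarrow> 'o \<Rightarrow> 'o" where
  "unshift T Y = (SOME X. X \<in> obj T \<and> isomorphic T (sobj T X) Y)"

definition shift :: "('o, 'm, 'z) tricat_scheme \<Rightarrow> int \<Rightarrow> 'o \<Rightarrow> 'o" where
  "shift T r X = (if 0 \<le> r then (sobj T ^^ nat r) X else (unshift T ^^ nat (- r)) X)"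

text \<open>Full subcategories are given by their sets of objects.\<close>

definition triangulated_subcategory :: "('o, 'm, 'z) tricat_scheme \<Rightarrow> 'o set \<Rightarrow> bool" where
  "triangulated_subcategory T D \<longleftrightarrow> D \<subseteq> obj T \<and>
     (\<forall>O'. is_zero_obj T O' \<longrightarrow> O' \<in> D) \<and>
     (\<forall>X Y. X \<in> D \<longrightarrow> isomorphic T X Y \<longrightarrow> Y \<in> D) \<and>
     (\<forall>X \<in> D. shift T 1 X \<in> D \<and> shift T (- 1) X \<in> D) \<and>
     (\<forall>X Y Z f g h. dist_tri T X Y Z f g h \<longrightarrow> X \<in> D \<longrightarrow> Y \<in> D \<longrightarrow> Z \<in> D)"

definition tria :: "('o, 'm, 'z) tricat_scheme \<Rightarrow> 'o set \<Rightarrow> 'o set" where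
  "tria T U = \<Inter> {D. triangulated_subcategory T D \<and> U \<subseteq> D}"

definition star :: "('o, 'm, 'z) tricat_scheme \<Rightarrow> 'o set \<Rightarrow> 'o set \<Rightarrow> 'o set" where
  "star T U V = {M \<in> obj T. \<exists>A \<in> U. \<exists>B \<in> V. \<exists>f g h. dist_tri T A M B f g h}"

primrec star_power :: "('o, 'm, 'z) tricat_scheme \<Rightarrow> 'o set \<Rightarrow> nat \<Rightarrow> 'o set" where
  "star_power T U 0 = {O'. is_zero_obj T O'}"
| "star_power T U (Suc n) = star T U (star_power T U n)"

definition extension_closure :: "('o, 'm, 'z) tricat_scheme \<Rightarrow> 'o set \<Rightarrow> 'o set" where
  "extension_closure T U = (\<Union>n. star_power T U n)"

definition iso_class :: "('o, 'm, 'z) cat_scheme \<Rightarrow> 'o \<Rightarrow> 'o set" where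
  "iso_class C X = {Y. isomorphic C X Y}"

definition K0_free :: "('o, 'm, 'z) tricat_scheme \<Rightarrow> ('o set \<Rightarrow>\<^sub>0 int) monoid" where
  "K0_free T = free_Abelian_group (iso_class T ` obj T)"

definition K0_relations :: "('o, 'm, 'z) tricat_scheme \<Rightarrow> ('o set \<Rightarrow>\<^sub>0 int) set" where
  "K0_relations T = generate (K0_free T)
     {frag_of (iso_class T X) - frag_of (iso_class T Y) + frag_of (iso_class T Z) |
        X Y Z. \<exists>f g h. dist_tri T X Y Z f g h}"

definition K0 :: "('o, 'm, 'z) tricat_scheme \<Rightarrow> ('o set \<Rightarrow>\<^sub>0 int) set monoid" where
  "K0 T = K0_free T Mod K0_relations T"

definition K0_class :: "('o, 'm, 'z) tricat_scheme \<Rightarrow> 'o \<Rightarrow> ('o set \<Rightarrow>\<^sub>0 int) set" where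
  "K0_class T X = K0_relations T #>\<^bsub>K0_free T\<^esub> frag_of (iso_class T X)"

text \<open>Bases of an abelian group (written multiplicatively) as a module over the integers.\<close>

definition is_Z_basis :: "('g, 'z) monoid_scheme \<Rightarrow> 'g set \<Rightarrow> bool" where
  "is_Z_basis G B \<longleftrightarrow> B \<subseteq> carrier G \<and> generate G B = carrier G \<and>
     (\<forall>F (c :: 'g \<Rightarrow> int). finite F \<longrightarrow> F \<subseteq> B \<longrightarrow>
        finprod G (\<lambda>b. b [^]\<^bsub>G\<^esub> c b) F = \<one>\<^bsub>G\<^esub> \<longrightarrow> (\<forall>b \<in> F. c b = 0))"

text \<open>The first morphism \<open>i v + j u\<close> is the column with entries \<open>v\<close> and \<open>u\<close>.\<close>

definition degen_triangle ::
  "('o, 'm, 'z) tricat_scheme \<Rightarrow> 'o \<Rightarrow> 'm \<Rightarrow> 'o \<Rightarrow> 'o \<Rightarrow> bool" where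
  "degen_triangle T Z v M N \<longleftrightarrow> Z \<in> obj T \<and> M \<in> obj T \<and> N \<in> obj T \<and> v \<in> hom_set T Z Z \<and>
     (\<exists>W i j p q u g h. u \<in> hom_set T Z M \<and> is_biproduct T Z M W i j p q \<and>
        dist_tri T Z W N ((i \<cdot>\<^bsub>T\<^esub> v) \<boxplus>\<^bsub>T\<^esub> (j \<cdot>\<^bsub>T\<^esub> u)) g h)"

definition le_Delta :: "('o, 'm, 'z) tricat_scheme \<Rightarrow> 'o \<Rightarrow> 'o \<Rightarrow> bool" where
  "le_Delta T M N \<longleftrightarrow> (\<exists>Z v. degen_triangle T Z v M N)"

definition le_Delta_nil :: "('o, 'm, 'z) tricat_scheme \<Rightarrow> 'o \<Rightarrow> 'o \<Rightarrow> bool" where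
  "le_Delta_nil T M N \<longleftrightarrow> (\<exists>Z v. degen_triangle T Z v M N \<and> nilpotent_endo T Z v)"

text \<open>The relation \<open>le_Delta_nil\<close> is invariant under isomorphism in both arguments, so its
  transitive closure on objects is that of the induced relation on isomorphism classes.\<close>

definition prec_Delta_nil :: "('o, 'm, 'z) tricat_scheme \<Rightarrow> 'o \<Rightarrow> 'o \<Rightarrow> bool" where
  "prec_Delta_nil T = (le_Delta_nil T)\<^sup>+\<^sup>+"

definition T0 :: "('o, 'm, 'z) tricat_scheme \<Rightarrow> 'o set" where
  "T0 T = {M \<in> obj T. K0_class T M = \<one>\<^bsub>K0 T\<^esub>}"

definition T0_Delta :: "('o, 'm, 'z) tricat_scheme \<Rightarrow> 'o set" where
  "T0_Delta T = {X \<in> obj T. \<exists>O'. is_zero_obj T O' \<and> le_Delta T O' X}"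

definition T0_Delta_nil :: "('o, 'm, 'z) tricat_scheme \<Rightarrow> 'o set" where
  "T0_Delta_nil T = {X \<in> obj T. \<exists>O'. is_zero_obj T O' \<and> le_Delta_nil T O' X}"

definition shifts :: "('o, 'm, 'z) tricat_scheme \<Rightarrow> 'o set \<Rightarrow> 'o set" where
  "shifts T U = {shift T r A | r A. A \<in> U}"

definition S_hat :: "('o, 'm, 'z) tricat_scheme \<Rightarrow> 'o set \<Rightarrow> 'o set" where
  "S_hat T S = {X \<in> finite_dsums T (shifts T S). K0_class T X = \<one>\<^bsub>K0 T\<^esub>}"

definition S_bar :: "('o, 'm, 'z) tricat_scheme \<Rightarrow> 'o set \<Rightarrow> 'o set" where
  "S_bar T S = {X. \<exists>A \<in> S. \<exists>k. is_dsum T A (shift T (2 * k + 1) A) X}"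

end

theory Submission
  imports Defs
begin

text \<open>
  The whole theorem rests on two facts: the equality
  \<open>T\<^sup>0 = tria(S \<oplus> S[t\<^sub>S])\<close>, and the remark that an object with a filtration degenerates to the
  direct sum of its factors.

  The equality is an instance of Thomason's classification of dense triangulated subcategories.
  Let \<open>D\<close> be the triangulated subcategory generated by the objects \<open>S \<oplus> S[t\<^sub>S]\<close>. It is contained
  in \<open>T\<^sup>0\<close> because \<open>[A[r]] = (-1)\<^sup>r [A]\<close> and \<open>t\<^sub>S\<close> is odd. The direct summands of objects of \<open>D\<close> form
  a triangulated subcategory (\<open>summands_triangulated\<close>) that contains the generators, so that every
  object \<open>X\<close> has a complement \<open>Z\<close>, meaning that \<open>X \<oplus> Z\<close> is in \<open>D\<close>. To \<open>X\<close> one attaches the set of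
  all its complements. These sets form an abelian group under direct sum
  (\<open>complement_group_comm_group\<close>), whose neutral element \<open>D\<close> is attached exactly to the objects
  of \<open>D\<close>, and the assignment is additive on distinguished triangles
  (\<open>complement_group_triangle\<close>). It therefore factors through \<open>K\<^sub>0\<close>, and an object of class zero is
  in \<open>D\<close> (\<open>T0_subset_dense\<close>).

  Taking \<open>t\<^sub>S = 1\<close>, every \<open>M\<close> in \<open>T\<^sup>0\<close> has a filtration \<open>0 = M\<^sub>0 \<rightarrow> M\<^sub>1 \<rightarrow> \<dots> \<rightarrow> M\<^sub>n = M\<close> whose factors \<open>U\<^sub>k\<close>
  are shifts of objects \<open>S \<oplus> S[1]\<close> (\<open>tria_subset_filtered\<close>). With \<open>Z = M\<^sub>1 \<oplus> \<dots> \<oplus> M\<^bsub>n-1\<^esub>\<close>, the sum of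
  the triangles \<open>M\<^bsub>k-1\<^esub> \<rightarrow> M\<^sub>k \<rightarrow> U\<^sub>k\<close> is a triangle \<open>Z \<rightarrow> Z \<oplus> M \<rightarrow> U\<^sub>1 \<oplus> \<dots> \<oplus> U\<^sub>n\<close> in which the
  endomorphism of \<open>Z\<close> is strictly triangular, hence nilpotent. So \<open>M\<close> degenerates in one nilpotent
  step to a direct sum of shifts of objects \<open>S \<oplus> S[1]\<close> (\<open>filtered_degeneration\<close>), which serves for
  both relations in the first assertion; the converse holds because a degeneration preserves classes
  in \<open>K\<^sub>0\<close>. As for the third assertion, \<open>B \<oplus> B[1]\<close> is the cone of the zero endomorphism of \<open>B\<close>, so
  that the factors \<open>U\<^sub>k\<close> are in \<open>T0_Delta_nil\<close>.
\<close>

section \<open>Categories\<close>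

text \<open>Composition and addition are partial. All rules are therefore stated in terms of sources and
  targets of morphisms, so that rewriting can discharge the typing conditions by itself.\<close>

context category
begin

lemma hom_iff: "f \<in> hom_set C X Y \<longleftrightarrow> f \<in> mor C \<and> src C f = X \<and> tgt C f = Y"
  by (simp add: hom_set_def)

lemma mor_obj [simp]: "f \<in> mor C \<Longrightarrow> src C f \<in> obj C" "f \<in> mor C \<Longrightarrow> tgt C f \<in> obj C"
  by (simp_all add: src_obj tgt_obj)

lemma hom_obj: "f \<in> hom_set C X Y \<Longrightarrow> X \<in> obj C" "f \<in> hom_set C X Y \<Longrightarrow> Y \<in> obj C"
  by (auto simp: hom_iff)

lemma cmp_typing [simp]:
  assumes "f \<in> mor C" "g \<in> mor C" "src C g = tgt C f"
  shows "g \<cdot> f \<in> mor C" "src C (g \<cdot> f) = src C f" "tgt C (g \<cdot> f) = tgt C g"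
  using cmp_hom[of f "src C f" "tgt C f" g "tgt C g"] assms by (simp_all add: hom_iff)

lemma cmp_assoc_right [simp]:
  assumes "f \<in> mor C" "g \<in> mor C" "h \<in> mor C" "src C g = tgt C f" "src C h = tgt C g"
  shows "(h \<cdot> g) \<cdot> f = h \<cdot> (g \<cdot> f)"
  using cmp_assoc[of f "src C f" "tgt C f" g "tgt C g" h "tgt C h"] assms by (simp add: hom_iff)

lemma ident_typing [simp]:
  assumes "X \<in> obj C"
  shows "ident C X \<in> mor C" "src C (ident C X) = X" "tgt C (ident C X) = X"
  using ident_hom[OF assms] by (simp_all add: hom_iff)

lemma ident_cmp [simp]:
  assumes "f \<in> mor C"
  shows "tgt C f = Y \<Longrightarrow> ident C Y \<cdot> f = f" "src C f = X \<Longrightarrow> f \<cdot> ident C X = f"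
  using ident_left[of f "src C f" "tgt C f"] ident_right[of f "src C f" "tgt C f"] assms
  by (auto simp: hom_iff)

text \<open>Composites are normalised to be nested to the right, where an equation \<open>g f = k\<close> no longer
  matches; this is the form in which it still applies.\<close>

lemma cmp_reassoc:
  assumes "g \<cdot> f = k" "f \<in> mor C" "g \<in> mor C" "src C g = tgt C f"
    and "x \<in> mor C" "tgt C x = src C f"
  shows "g \<cdot> (f \<cdot> x) = k \<cdot> x"
  using cmp_assoc_right[of x f g] assms by simp

lemma is_isomI:
  assumes "f \<in> hom_set C X Y" "g \<in> hom_set C Y X" "g \<cdot> f = ident C X" "f \<cdot> g = ident C Y"
  shows "is_isom C X Y f"
  using assms by (auto simp: is_isom_def)

lemma is_isomE:
  assumes "is_isom C X Y f"
  obtains g where "f \<in> hom_set C X Y" "g \<in> hom_set C Y X" "g \<cdot> f = ident C X" "f \<cdot> g = ident C Y"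
    "is_isom C Y X g" "X \<in> obj C" "Y \<in> obj C"
  using assms unfolding is_isom_def by (auto dest: hom_obj)

lemma is_isom_ident [simp]: "X \<in> obj C \<Longrightarrow> is_isom C X X (ident C X)"
  by (rule is_isomI[of _ _ _ "ident C X"]) (auto simp: hom_iff)

lemma is_isom_one_sided:
  assumes c: "c \<in> hom_set C X Y" and l: "l \<in> hom_set C Y X" "l \<cdot> c = ident C X"
    and r: "r \<in> hom_set C Y X" "c \<cdot> r = ident C Y"
  shows "is_isom C X Y c"
proof -
  note t = c[unfolded hom_iff] l(1)[unfolded hom_iff] r(1)[unfolded hom_iff]
  have "l = l \<cdot> (c \<cdot> r)" using t r(2) by simp
  also have "\<dots> = (l \<cdot> c) \<cdot> r" using t by simp
  also have "\<dots> = r" using t l(2) by simp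
  finally show ?thesis using assms by (intro is_isomI[of _ _ _ l]) auto
qed

lemma is_isom_cmp:
  assumes f: "is_isom C X Y f" and g: "is_isom C Y Z g"
  shows "is_isom C X Z (g \<cdot> f)"
proof -
  obtain f' where f': "f \<in> hom_set C X Y" "f' \<in> hom_set C Y X" "f' \<cdot> f = ident C X"
    "f \<cdot> f' = ident C Y" using f by (rule is_isomE)
  obtain g' where g': "g \<in> hom_set C Y Z" "g' \<in> hom_set C Z Y" "g' \<cdot> g = ident C Y"
    "g \<cdot> g' = ident C Z" using g by (rule is_isomE)
  note t = f'[unfolded hom_iff] g'[unfolded hom_iff]
  show ?thesis
    by (rule is_isomI[of _ _ _ "f' \<cdot> g'"])
      (use t in \<open>simp_all add: hom_iff cmp_reassoc[OF g'(3)] cmp_reassoc[OF f'(4)]\<close>)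
qed

lemma isomorphic_refl [simp]: "X \<in> obj C \<Longrightarrow> isomorphic C X X"
  using is_isom_ident unfolding isomorphic_def by blast

lemma isomorphic_sym: "isomorphic C X Y \<Longrightarrow> isomorphic C Y X"
  unfolding isomorphic_def by (auto elim: is_isomE)

lemma isomorphic_trans: "isomorphic C X Y \<Longrightarrow> isomorphic C Y Z \<Longrightarrow> isomorphic C X Z"
  unfolding isomorphic_def by (auto intro: is_isom_cmp)

lemma isomorphic_obj: "isomorphic C X Y \<Longrightarrow> X \<in> obj C" "isomorphic C X Y \<Longrightarrow> Y \<in> obj C"
  by (simp_all add: isomorphic_def)

lemma iso_class_eq: "isomorphic C X Y \<Longrightarrow> iso_class C X = iso_class C Y"
  unfolding iso_class_def by (auto intro: isomorphic_trans isomorphic_sym)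

end

section \<open>Additive categories\<close>

context additive_category
begin

lemma hom_group_simps [simp]:
  "carrier (hom_group C X Y) = hom_set C X Y" "mult (hom_group C X Y) = hadd C"
  "one (hom_group C X Y) = hzero C X Y"
  by (simp_all add: hom_group_def)

lemma hadd_typing [simp]:
  assumes "f \<in> mor C" "g \<in> mor C" "src C f = src C g" "tgt C f = tgt C g"
  shows "f \<boxplus> g \<in> mor C" "src C (f \<boxplus> g) = src C g" "tgt C (f \<boxplus> g) = tgt C g"
proof -
  interpret G: comm_group "hom_group C (src C g) (tgt C g)"
    using assms by (intro hom_comm_group) auto
  have "f \<boxplus> g \<in> hom_set C (src C g) (tgt C g)"
    using G.m_closed[of f g] assms by (simp add: hom_iff)
  then show "f \<boxplus> g \<in> mor C" "src C (f \<boxplus> g) = src C g" "tgt C (f \<boxplus> g) = tgt C g"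
    by (simp_all add: hom_iff)
qed

lemma hzero_typing [simp]:
  assumes "X \<in> obj C" "Y \<in> obj C"
  shows "hzero C X Y \<in> mor C" "src C (hzero C X Y) = X" "tgt C (hzero C X Y) = Y"
proof -
  interpret G: comm_group "hom_group C X Y"
    using assms by (intro hom_comm_group) auto
  have "hzero C X Y \<in> hom_set C X Y"
    using G.one_closed by simp
  then show "hzero C X Y \<in> mor C" "src C (hzero C X Y) = X" "tgt C (hzero C X Y) = Y"
    by (simp_all add: hom_iff)
qed

lemma hneg_typing [simp]:
  assumes "f \<in> mor C"
  shows "hneg C f \<in> mor C" "src C (hneg C f) = src C f" "tgt C (hneg C f) = tgt C f"
proof -
  interpret G: comm_group "hom_group C (src C f) (tgt C f)"
    using assms by (intro hom_comm_group) auto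
  have "hneg C f \<in> hom_set C (src C f) (tgt C f)"
    using G.inv_closed[of f] assms by (simp add: hneg_def hom_iff)
  then show "hneg C f \<in> mor C" "src C (hneg C f) = src C f" "tgt C (hneg C f) = tgt C f"
    by (simp_all add: hom_iff)
qed

lemma hadd_commute:
  assumes "f \<in> mor C" "g \<in> mor C" "src C f = src C g" "tgt C f = tgt C g"
  shows "f \<boxplus> g = g \<boxplus> f"
proof -
  interpret G: comm_group "hom_group C (src C g) (tgt C g)"
    using assms by (intro hom_comm_group) auto
  show ?thesis using G.m_comm[of f g] assms by (simp add: hom_iff)
qed

lemma hadd_assoc:
  assumes "f \<in> mor C" "g \<in> mor C" "h \<in> mor C" "src C f = src C g" "tgt C f = tgt C g"
    "src C g = src C h" "tgt C g = tgt C h"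
  shows "(f \<boxplus> g) \<boxplus> h = f \<boxplus> (g \<boxplus> h)"
proof -
  interpret G: comm_group "hom_group C (src C g) (tgt C g)"
    using assms by (intro hom_comm_group) auto
  show ?thesis using G.m_assoc[of f g h] assms by (simp add: hom_iff)
qed

lemma hadd_hzero [simp]:
  assumes "f \<in> mor C" "src C f = X" "tgt C f = Y"
  shows "f \<boxplus> hzero C X Y = f" "hzero C X Y \<boxplus> f = f"
proof -
  interpret G: comm_group "hom_group C X Y"
    using assms by (intro hom_comm_group) auto
  show "f \<boxplus> hzero C X Y = f" "hzero C X Y \<boxplus> f = f"
    using G.r_one[of f] G.l_one[of f] assms by (simp_all add: hom_iff)
qed

lemma hadd_hneg [simp]:
  assumes "f \<in> mor C"
  shows "f \<boxplus> hneg C f = hzero C (src C f) (tgt C f)" "hneg C f \<boxplus> f = hzero C (src C f) (tgt C f)"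
proof -
  interpret G: comm_group "hom_group C (src C f) (tgt C f)"
    using assms by (intro hom_comm_group) auto
  show "f \<boxplus> hneg C f = hzero C (src C f) (tgt C f)" "hneg C f \<boxplus> f = hzero C (src C f) (tgt C f)"
    using G.r_inv[of f] G.l_inv[of f] assms by (simp_all add: hneg_def hom_iff)
qed

lemma hneg_unique:
  assumes "f \<in> mor C" "g \<in> mor C" "src C f = src C g" "tgt C f = tgt C g"
    and "f \<boxplus> g = hzero C (src C g) (tgt C g)"
  shows "hneg C g = f"
proof -
  interpret G: comm_group "hom_group C (src C g) (tgt C g)"
    using assms by (intro hom_comm_group) auto
  show ?thesis using G.inv_equality[of f g] assms by (simp add: hneg_def hom_iff)
qed

lemma hneg_hneg [simp]: "f \<in> mor C \<Longrightarrow> hneg C (hneg C f) = f"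
  by (rule hneg_unique) auto

lemma idempotent_hzero:
  assumes "f \<in> mor C" "f \<boxplus> f = f"
  shows "f = hzero C (src C f) (tgt C f)"
proof -
  have "f = f \<boxplus> (f \<boxplus> hneg C f)" using assms(1) by simp
  also have "\<dots> = (f \<boxplus> f) \<boxplus> hneg C f" using assms(1) by (subst hadd_assoc) auto
  also have "\<dots> = hzero C (src C f) (tgt C f)" using assms(1) by (simp add: assms(2))
  finally show ?thesis .
qed

lemma cmp_hadd [simp]:
  assumes "f \<in> mor C" "f' \<in> mor C" "g \<in> mor C" "src C f = src C f'" "tgt C f = tgt C f'"
    "src C g = tgt C f'"
  shows "g \<cdot> (f \<boxplus> f') = g \<cdot> f \<boxplus> g \<cdot> f'"
  using cmp_add_left[of f "src C f'" "tgt C f'" f' g "tgt C g"] assms by (simp add: hom_iff)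

lemma hadd_cmp [simp]:
  assumes "f \<in> mor C" "g \<in> mor C" "g' \<in> mor C" "src C g = src C g'" "tgt C g = tgt C g'"
    "src C g' = tgt C f"
  shows "(g \<boxplus> g') \<cdot> f = g \<cdot> f \<boxplus> g' \<cdot> f"
  using cmp_add_right[of f "src C f" "tgt C f" g "tgt C g'" g'] assms by (simp add: hom_iff)

lemma cmp_hzero [simp]:
  assumes "g \<in> mor C" "X \<in> obj C" "src C g = Y"
  shows "g \<cdot> hzero C X Y = hzero C X (tgt C g)"
proof -
  have "g \<cdot> hzero C X Y \<boxplus> g \<cdot> hzero C X Y = g \<cdot> (hzero C X Y \<boxplus> hzero C X Y)"
    using assms by (subst cmp_hadd) auto
  also have "\<dots> = g \<cdot> hzero C X Y" using assms by (subst hadd_hzero) auto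
  finally show ?thesis using idempotent_hzero[of "g \<cdot> hzero C X Y"] assms by auto
qed

lemma hzero_cmp [simp]:
  assumes "f \<in> mor C" "Z \<in> obj C" "tgt C f = Y"
  shows "hzero C Y Z \<cdot> f = hzero C (src C f) Z"
proof -
  have "hzero C Y Z \<cdot> f \<boxplus> hzero C Y Z \<cdot> f = (hzero C Y Z \<boxplus> hzero C Y Z) \<cdot> f"
    using assms by (subst hadd_cmp) auto
  also have "\<dots> = hzero C Y Z \<cdot> f" using assms by (subst hadd_hzero) auto
  finally show ?thesis using idempotent_hzero[of "hzero C Y Z \<cdot> f"] assms by auto
qed

lemma cmp_hneg:
  assumes "f \<in> mor C" "g \<in> mor C" "src C g = tgt C f"
  shows "g \<cdot> hneg C f = hneg C (g \<cdot> f)" "hneg C g \<cdot> f = hneg C (g \<cdot> f)"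
proof -
  have "g \<cdot> hneg C f \<boxplus> g \<cdot> f = g \<cdot> (hneg C f \<boxplus> f)" using assms by (subst cmp_hadd) auto
  also have "\<dots> = hzero C (src C f) (tgt C g)" using assms by (subst hadd_hneg) auto
  finally show "g \<cdot> hneg C f = hneg C (g \<cdot> f)" 
    using assms by (intro hneg_unique[symmetric]) auto
  have "hneg C g \<cdot> f \<boxplus> g \<cdot> f = (hneg C g \<boxplus> g) \<cdot> f" using assms by (subst hadd_cmp) auto
  also have "\<dots> = hzero C (src C f) (tgt C g)" using assms by (subst hadd_hneg) auto
  finally show "hneg C g \<cdot> f = hneg C (g \<cdot> f)" 
    using assms by (intro hneg_unique[symmetric]) auto
qed

text \<open>Stated as an equation, the universal property of a zero object can be used for rewriting.\<close>

lemma zero_obj_iff: "is_zero_obj C Z \<longleftrightarrow> Z \<in> obj C \<and> ident C Z = hzero C Z Z"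
proof
  assume z: "is_zero_obj C Z"
  then have "\<exists>!f. f \<in> hom_set C Z Z" "Z \<in> obj C" by (auto simp: is_zero_obj_def)
  moreover from this have "ident C Z \<in> hom_set C Z Z" "hzero C Z Z \<in> hom_set C Z Z"
    by (auto simp: hom_iff)
  ultimately show "Z \<in> obj C \<and> ident C Z = hzero C Z Z" by blast
next
  assume z: "Z \<in> obj C \<and> ident C Z = hzero C Z Z"
  show "is_zero_obj C Z"
    unfolding is_zero_obj_def
  proof (intro conjI ballI)
    fix X assume X: "X \<in> obj C"
    show "\<exists>!f. f \<in> hom_set C Z X"
    proof (rule ex1I)
      show "hzero C Z X \<in> hom_set C Z X" using z X by (simp add: hom_iff)
      fix f assume f: "f \<in> hom_set C Z X"
      then have "f = f \<cdot> hzero C Z Z" using z by (metis ident_right)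
      then show "f = hzero C Z X" using f z by (auto simp: hom_iff)
    qed
    show "\<exists>!f. f \<in> hom_set C X Z"
    proof (rule ex1I)
      show "hzero C X Z \<in> hom_set C X Z" using z X by (simp add: hom_iff)
      fix f assume f: "f \<in> hom_set C X Z"
      then have "f = hzero C Z Z \<cdot> f" using z by (metis ident_left)
      then show "f = hzero C X Z" using f z by (auto simp: hom_iff)
    qed
  qed (use z in auto)
qed

lemma zero_obj_obj: "is_zero_obj C Z \<Longrightarrow> Z \<in> obj C"
  by (simp add: is_zero_obj_def)

lemma zero_obj_hom:
  assumes "is_zero_obj C Z"
  shows "f \<in> hom_set C Z X \<Longrightarrow> f = hzero C Z X" "f \<in> hom_set C X Z \<Longrightarrow> f = hzero C X Z"
proof -
  have Z: "Z \<in> obj C" using assms by (rule zero_obj_obj)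
  assume f: "f \<in> hom_set C Z X"
  then have "X \<in> obj C" by (rule hom_obj)
  then have "\<exists>!f. f \<in> hom_set C Z X" "hzero C Z X \<in> hom_set C Z X"
    using assms Z by (auto simp: is_zero_obj_def hom_iff)
  then show "f = hzero C Z X" using f by blast
next
  have Z: "Z \<in> obj C" using assms by (rule zero_obj_obj)
  assume f: "f \<in> hom_set C X Z"
  then have "X \<in> obj C" by (rule hom_obj)
  then have "\<exists>!f. f \<in> hom_set C X Z" "hzero C X Z \<in> hom_set C X Z"
    using assms Z by (auto simp: is_zero_obj_def hom_iff)
  then show "f = hzero C X Z" using f by blast
qed

lemma zero_obj_iso:
  assumes "is_zero_obj C Z" "isomorphic C Z Z'"
  shows "is_zero_obj C Z'"
proof -
  obtain f where "is_isom C Z Z' f" using assms(2) by (auto simp: isomorphic_def)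
  then obtain g where g: "f \<in> hom_set C Z Z'" "g \<in> hom_set C Z' Z" "f \<cdot> g = ident C Z'"
    by (rule is_isomE)
  have "f = hzero C Z Z'" by (rule zero_obj_hom(1)[OF assms(1) g(1)])
  then have "ident C Z' = hzero C Z' Z'"
    using g hom_obj[OF g(1)] by (auto simp: hom_iff)
  then show ?thesis using hom_obj[OF g(1)] by (simp add: zero_obj_iff)
qed

lemma zero_obj_isomorphic:
  assumes "is_zero_obj C Z" "is_zero_obj C Z'"
  shows "isomorphic C Z Z'"
proof -
  have "is_isom C Z Z' (hzero C Z Z')"
    by (rule is_isomI[of _ _ _ "hzero C Z' Z"])
      (use assms in \<open>auto simp: zero_obj_iff hom_iff\<close>)
  then show ?thesis using assms by (auto simp: isomorphic_def zero_obj_obj)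
qed

subsection \<open>Direct sums\<close>

lemma biproduct_simps:
  assumes "is_biproduct C A B W i j p q"
  shows "i \<in> mor C" "src C i = A" "tgt C i = W" "j \<in> mor C" "src C j = B" "tgt C j = W"
    "p \<in> mor C" "src C p = W" "tgt C p = A" "q \<in> mor C" "src C q = W" "tgt C q = B"
    "A \<in> obj C" "B \<in> obj C" "W \<in> obj C"
    "p \<cdot> i = ident C A" "q \<cdot> j = ident C B" "q \<cdot> i = hzero C A B" "p \<cdot> j = hzero C B A"
    "\<And>x. x \<in> mor C \<Longrightarrow> tgt C x = A \<Longrightarrow> p \<cdot> (i \<cdot> x) = x"
    "\<And>x. x \<in> mor C \<Longrightarrow> tgt C x = B \<Longrightarrow> q \<cdot> (j \<cdot> x) = x"
    "\<And>x. x \<in> mor C \<Longrightarrow> tgt C x = A \<Longrightarrow> q \<cdot> (i \<cdot> x) = hzero C (src C x) B"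
    "\<And>x. x \<in> mor C \<Longrightarrow> tgt C x = B \<Longrightarrow> p \<cdot> (j \<cdot> x) = hzero C (src C x) A"
proof -
  show *: "i \<in> mor C" "src C i = A" "tgt C i = W" "j \<in> mor C" "src C j = B" "tgt C j = W"
    "p \<in> mor C" "src C p = W" "tgt C p = A" "q \<in> mor C" "src C q = W" "tgt C q = B"
    "p \<cdot> i = ident C A" "q \<cdot> j = ident C B" "q \<cdot> i = hzero C A B" "p \<cdot> j = hzero C B A"
    using assms by (auto simp: is_biproduct_def hom_iff)
  show **: "A \<in> obj C" "B \<in> obj C" "W \<in> obj C"
    using mor_obj[OF *(1)] mor_obj[OF *(4)] * by auto
  show "p \<cdot> (i \<cdot> x) = x" "q \<cdot> (i \<cdot> x) = hzero C (src C x) B"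
    if "x \<in> mor C" "tgt C x = A" for x
    using that * ** cmp_reassoc[of p i "ident C A" x] cmp_reassoc[of q i "hzero C A B" x] by simp_all
  show "q \<cdot> (j \<cdot> x) = x" "p \<cdot> (j \<cdot> x) = hzero C (src C x) A"
    if "x \<in> mor C" "tgt C x = B" for x
    using that * ** cmp_reassoc[of q j "ident C B" x] cmp_reassoc[of p j "hzero C B A" x] by simp_all
qed

lemma biproduct_sum:
  assumes "is_biproduct C A B W i j p q"
  shows "i \<cdot> p \<boxplus> j \<cdot> q = ident C W"
    and "x \<in> mor C \<Longrightarrow> tgt C x = W \<Longrightarrow> i \<cdot> (p \<cdot> x) \<boxplus> j \<cdot> (q \<cdot> x) = x"
    and "y \<in> mor C \<Longrightarrow> src C y = W \<Longrightarrow> y \<cdot> (i \<cdot> p) \<boxplus> y \<cdot> (j \<cdot> q) = y"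
proof -
  note b = biproduct_simps[OF assms]
  show *: "i \<cdot> p \<boxplus> j \<cdot> q = ident C W" using assms by (simp add: is_biproduct_def)
  show "i \<cdot> (p \<cdot> x) \<boxplus> j \<cdot> (q \<cdot> x) = x" if "x \<in> mor C" "tgt C x = W"
  proof -
    have "(i \<cdot> p \<boxplus> j \<cdot> q) \<cdot> x = x" using that * by simp
    then show ?thesis using that by (simp add: b)
  qed
  show "y \<cdot> (i \<cdot> p) \<boxplus> y \<cdot> (j \<cdot> q) = y" if "y \<in> mor C" "src C y = W"
  proof -
    have "y \<cdot> (i \<cdot> p \<boxplus> j \<cdot> q) = y" using that * by simp
    then show ?thesis using that by (simp add: b)
  qed
qed

lemma is_dsumI: "is_biproduct C A B W i j p q \<Longrightarrow> is_dsum C A B W"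
  using biproduct_simps(13-15) by (fastforce simp: is_dsum_def)

lemma is_dsumE:
  assumes "is_dsum C A B W"
  obtains i j p q where "is_biproduct C A B W i j p q"
  using assms by (auto simp: is_dsum_def)

lemma is_dsum_obj:
  assumes "is_dsum C A B W"
  shows "A \<in> obj C" "B \<in> obj C" "W \<in> obj C"
  using assms by (auto simp: is_dsum_def)

lemma biproductI:
  assumes "i \<in> hom_set C A W" "j \<in> hom_set C B W" "p \<in> hom_set C W A" "q \<in> hom_set C W B"
    "p \<cdot> i = ident C A" "q \<cdot> j = ident C B" "q \<cdot> i = hzero C A B" "p \<cdot> j = hzero C B A"
    "i \<cdot> p \<boxplus> j \<cdot> q = ident C W"
  shows "is_biproduct C A B W i j p q"
  using assms by (simp add: is_biproduct_def)

lemma biproduct_commute: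
  assumes "is_biproduct C A B W i j p q" shows "is_biproduct C B A W j i q p"
  using assms biproduct_sum[OF assms] hadd_commute[of "j \<cdot> q" "i \<cdot> p"]
  by (auto simp: is_biproduct_def biproduct_simps[OF assms])

lemma is_dsum_commute: "is_dsum C A B W \<Longrightarrow> is_dsum C B A W"
  by (auto elim!: is_dsumE intro: is_dsumI biproduct_commute)

lemma biproduct_zero_right:
  assumes "A \<in> obj C" "is_zero_obj C Z"
  shows "is_biproduct C A Z A (ident C A) (hzero C Z A) (ident C A) (hzero C A Z)"
  by (rule biproductI) (use assms in \<open>auto simp: hom_iff zero_obj_iff\<close>)

lemma biproduct_zero_left:
  assumes "A \<in> obj C" "is_zero_obj C Z"
  shows "is_biproduct C Z A A (hzero C Z A) (ident C A) (hzero C A Z) (ident C A)"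
  by (rule biproductI) (use assms in \<open>auto simp: hom_iff zero_obj_iff\<close>)

lemma is_dsum_iso:
  assumes d: "is_dsum C A B W" and iso: "isomorphic C A A'" "isomorphic C B B'" "isomorphic C W W'"
  shows "is_dsum C A' B' W'"
proof -
  obtain i j p q where b: "is_biproduct C A B W i j p q" using d by (rule is_dsumE)
  obtain a where "is_isom C A A' a" using iso by (auto simp: isomorphic_def)
  then obtain a' where a: "a \<in> hom_set C A A'" "a' \<in> hom_set C A' A" "a' \<cdot> a = ident C A"
    "a \<cdot> a' = ident C A'" "A \<in> obj C" "A' \<in> obj C" by (auto elim: is_isomE)
  obtain c where "is_isom C B B' c" using iso by (auto simp: isomorphic_def)
  then obtain c' where c: "c \<in> hom_set C B B'" "c' \<in> hom_set C B' B" "c' \<cdot> c = ident C B"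
    "c \<cdot> c' = ident C B'" "B \<in> obj C" "B' \<in> obj C" by (auto elim: is_isomE)
  obtain w where "is_isom C W W' w" using iso by (auto simp: isomorphic_def)
  then obtain w' where w: "w \<in> hom_set C W W'" "w' \<in> hom_set C W' W" "w' \<cdot> w = ident C W"
    "w \<cdot> w' = ident C W'" "W \<in> obj C" "W' \<in> obj C" by (auto elim: is_isomE)
  note t = a[unfolded hom_iff] c[unfolded hom_iff] w[unfolded hom_iff] biproduct_simps[OF b]
  note r = t cmp_reassoc[OF a(3)] cmp_reassoc[OF a(4)] cmp_reassoc[OF c(3)] cmp_reassoc[OF c(4)]
    cmp_reassoc[OF w(3)] cmp_reassoc[OF w(4)]
  have "w \<cdot> (i \<cdot> (p \<cdot> w')) \<boxplus> w \<cdot> (j \<cdot> (q \<cdot> w')) = w \<cdot> (i \<cdot> (p \<cdot> w') \<boxplus> j \<cdot> (q \<cdot> w'))"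
    using t by simp
  also have "\<dots> = ident C W'" using t by (subst biproduct_sum[OF b]) auto
  finally have s: "w \<cdot> (i \<cdot> (p \<cdot> w')) \<boxplus> w \<cdot> (j \<cdot> (q \<cdot> w')) = ident C W'" .
  have "is_biproduct C A' B' W' (w \<cdot> (i \<cdot> a')) (w \<cdot> (j \<cdot> c')) (a \<cdot> (p \<cdot> w')) (c \<cdot> (q \<cdot> w'))"
    by (rule biproductI) (use r s in \<open>simp_all add: hom_iff\<close>)
  then show ?thesis by (rule is_dsumI)
qed

lemma is_dsum_unique:
  assumes "is_dsum C A B W" "is_dsum C A B W'"
  shows "isomorphic C W W'"
proof -
  obtain i j p q where b: "is_biproduct C A B W i j p q" using assms(1) by (rule is_dsumE)
  obtain i' j' p' q' where b': "is_biproduct C A B W' i' j' p' q'" using assms(2) by (rule is_dsumE)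
  note t = biproduct_simps[OF b] biproduct_simps[OF b']
  have "is_isom C W W' (i' \<cdot> p \<boxplus> j' \<cdot> q)"
    by (rule is_isomI[of _ _ _ "i \<cdot> p' \<boxplus> j \<cdot> q'"])
      (use t in \<open>simp_all add: hom_iff biproduct_sum[OF b] biproduct_sum[OF b']\<close>)
  then show ?thesis using t by (auto simp: isomorphic_def)
qed

lemma is_dsum_assoc:
  assumes d: "is_dsum C X Y V" "is_dsum C V Z W" and U: "is_dsum C Y Z U"
  shows "is_dsum C X U W"
proof -
  obtain i j p q where b: "is_biproduct C X Y V i j p q" using d(1) by (rule is_dsumE)
  obtain i1 j1 p1 q1 where b1: "is_biproduct C V Z W i1 j1 p1 q1" using d(2) by (rule is_dsumE)
  obtain i2 j2 p2 q2 where b2: "is_biproduct C Y Z U i2 j2 p2 q2" using U by (rule is_dsumE)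
  note t = biproduct_simps[OF b] biproduct_simps[OF b1] biproduct_simps[OF b2]
  have "i1 \<cdot> (i \<cdot> (p \<cdot> p1)) \<boxplus> (i1 \<cdot> (j \<cdot> (q \<cdot> p1)) \<boxplus> j1 \<cdot> q1)
      = (i1 \<cdot> (i \<cdot> (p \<cdot> p1)) \<boxplus> i1 \<cdot> (j \<cdot> (q \<cdot> p1))) \<boxplus> j1 \<cdot> q1"
    using t by (subst hadd_assoc) auto
  also have "i1 \<cdot> (i \<cdot> (p \<cdot> p1)) \<boxplus> i1 \<cdot> (j \<cdot> (q \<cdot> p1)) = i1 \<cdot> ((i \<cdot> (p \<cdot> p1)) \<boxplus> (j \<cdot> (q \<cdot> p1)))"
    using t by simp
  also have "\<dots> = i1 \<cdot> p1" using t by (subst biproduct_sum[OF b]) auto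
  also have "i1 \<cdot> p1 \<boxplus> j1 \<cdot> q1 = ident C W" by (rule biproduct_sum[OF b1])
  finally have s: "i1 \<cdot> (i \<cdot> (p \<cdot> p1)) \<boxplus> (i1 \<cdot> (j \<cdot> (q \<cdot> p1)) \<boxplus> j1 \<cdot> q1) = ident C W" .
  have "is_biproduct C X U W (i1 \<cdot> i) (i1 \<cdot> (j \<cdot> p2) \<boxplus> j1 \<cdot> q2)
    (p \<cdot> p1) (i2 \<cdot> (q \<cdot> p1) \<boxplus> j2 \<cdot> q1)"
    by (rule biproductI) (use t s in \<open>simp_all add: hom_iff biproduct_sum[OF b2]\<close>)
  then show ?thesis by (rule is_dsumI)
qed

end

context triangulated_category
begin

section \<open>Triangles\<close>

subsection \<open>The shift functor\<close>

declare sobj_obj [simp]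

lemma smor_typing [simp]:
  assumes "f \<in> mor T"
  shows "smor T f \<in> mor T" "src T (smor T f) = sobj T (src T f)" "tgt T (smor T f) = sobj T (tgt T f)"
proof -
  have "smor T f \<in> hom_set T (sobj T (src T f)) (sobj T (tgt T f))"
    using bij_betwE[OF smor_bij[of "src T f" "tgt T f"]] assms by (simp add: hom_iff)
  then show "smor T f \<in> mor T" "src T (smor T f) = sobj T (src T f)"
    "tgt T (smor T f) = sobj T (tgt T f)"
    by (simp_all add: hom_iff)
qed

lemma smor_cmp_mor:
  assumes "f \<in> mor T" "g \<in> mor T" "src T g = tgt T f"
  shows "smor T (g \<cdot> f) = smor T g \<cdot> smor T f"
  using smor_cmp[of f "src T f" "tgt T f" g "tgt T g"] assms by (simp add: hom_iff)

lemma smor_hadd_mor: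
  assumes "f \<in> mor T" "g \<in> mor T" "src T f = src T g" "tgt T f = tgt T g"
  shows "smor T (f \<boxplus> g) = smor T f \<boxplus> smor T g"
  using smor_add[of f "src T f" "tgt T f" g] assms by (simp add: hom_iff)

lemma smor_hzero [simp]:
  assumes "X \<in> obj T" "Y \<in> obj T"
  shows "smor T (hzero T X Y) = hzero T (sobj T X) (sobj T Y)"
  using idempotent_hzero[of "smor T (hzero T X Y)"] smor_hadd_mor[of "hzero T X Y" "hzero T X Y"]
    assms by simp

lemma smor_fullE:
  assumes "g \<in> hom_set T (sobj T X) (sobj T Y)" "X \<in> obj T" "Y \<in> obj T"
  obtains f where "f \<in> hom_set T X Y" "smor T f = g"
proof -
  have "g \<in> smor T ` hom_set T X Y"
    using smor_bij[OF assms(2,3)] assms(1) by (simp add: bij_betw_def)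
  then show ?thesis using that by blast
qed

lemma smor_inject:
  assumes "smor T f = smor T g" "f \<in> hom_set T X Y" "g \<in> hom_set T X Y"
  shows "f = g"
  using smor_bij[of X Y] assms hom_obj[OF assms(2)] by (auto simp: bij_betw_def inj_on_def)

lemma biproduct_shift:
  assumes b: "is_biproduct T A B W i j p q"
  shows "is_biproduct T (sobj T A) (sobj T B) (sobj T W) (smor T i) (smor T j) (smor T p) (smor T q)"
proof -
  note t = biproduct_simps[OF b]
  have "smor T (i \<cdot> p \<boxplus> j \<cdot> q) = smor T (i \<cdot> p) \<boxplus> smor T (j \<cdot> q)"
    by (rule smor_hadd_mor) (use t in auto)
  then show ?thesis
    by (intro biproductI; (simp add: hom_iff t flip: smor_cmp_mor smor_ident)?)
      (use t in \<open>simp_all add: biproduct_sum[OF b] smor_ident flip: smor_cmp_mor\<close>)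
qed

lemma is_dsum_shift: "is_dsum T A B W \<Longrightarrow> is_dsum T (sobj T A) (sobj T B) (sobj T W)"
  by (auto elim!: is_dsumE intro: is_dsumI biproduct_shift)

lemma isomorphic_shift:
  assumes "isomorphic T X Y" shows "isomorphic T (sobj T X) (sobj T Y)"
proof -
  obtain f where "is_isom T X Y f" using assms by (auto simp: isomorphic_def)
  then obtain g where g: "f \<in> hom_set T X Y" "g \<in> hom_set T Y X" "g \<cdot> f = ident T X"
    "f \<cdot> g = ident T Y" "X \<in> obj T" "Y \<in> obj T" by (rule is_isomE)
  have "is_isom T (sobj T X) (sobj T Y) (smor T f)"
    by (rule is_isomI[of _ _ _ "smor T g"])
      (use g in \<open>simp_all add: hom_iff smor_ident flip: smor_cmp_mor\<close>)
  then show ?thesis using g by (auto simp: isomorphic_def)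
qed

text \<open>The shift is fully faithful and so reflects isomorphisms.\<close>

lemma isomorphic_shift_cancel:
  assumes "isomorphic T (sobj T X) (sobj T Y)" "X \<in> obj T" "Y \<in> obj T"
  shows "isomorphic T X Y"
proof -
  obtain f where "is_isom T (sobj T X) (sobj T Y) f" using assms by (auto simp: isomorphic_def)
  then obtain g where g: "f \<in> hom_set T (sobj T X) (sobj T Y)" "g \<in> hom_set T (sobj T Y) (sobj T X)"
    "g \<cdot> f = ident T (sobj T X)" "f \<cdot> g = ident T (sobj T Y)" by (rule is_isomE)
  obtain a where a: "a \<in> hom_set T X Y" "smor T a = f" using smor_fullE[OF g(1)] assms by blast
  obtain b where b: "b \<in> hom_set T Y X" "smor T b = g" using smor_fullE[OF g(2)] assms by blast
  have "b \<cdot> a = ident T X"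
    by (rule smor_inject[of _ _ X X])
      (use a b g assms in \<open>auto simp: hom_iff smor_cmp_mor smor_ident\<close>)
  moreover have "a \<cdot> b = ident T Y"
    by (rule smor_inject[of _ _ Y Y])
      (use a b g assms in \<open>auto simp: hom_iff smor_cmp_mor smor_ident\<close>)
  ultimately have "is_isom T X Y a" using a b by (intro is_isomI[of _ _ _ b]) auto
  then show ?thesis using assms by (auto simp: isomorphic_def)
qed

lemma unshift_obj_iso:
  assumes "Y \<in> obj T"
  shows "unshift T Y \<in> obj T" "isomorphic T (sobj T (unshift T Y)) Y"
  using someI_ex[OF sobj_ess_surj[OF assms]] by (auto simp: unshift_def)

lemma zero_obj_shift: "is_zero_obj T Z \<Longrightarrow> is_zero_obj T (sobj T Z)"
  using smor_ident[of Z] by (auto simp: zero_obj_iff)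

subsection \<open>Elementary consequences of the axioms\<close>

lemma dist_tri_simps:
  assumes "dist_tri T X Y Z f g h"
  shows "f \<in> mor T" "src T f = X" "tgt T f = Y" "g \<in> mor T" "src T g = Y" "tgt T g = Z"
    "h \<in> mor T" "src T h = Z" "tgt T h = sobj T X" "X \<in> obj T" "Y \<in> obj T" "Z \<in> obj T"
  using assms by (auto simp: dist_tri_def hom_iff)

lemma dist_tri_rotate:
  "dist_tri T X Y Z f g h \<Longrightarrow> dist_tri T Y Z (sobj T X) g h (hneg T (smor T f))"
  using tri_rotate[of f X Y g Z h] by (simp add: dist_tri_def)

text \<open>This is the axiom for \<open>X = X \<rightarrow> 0\<close> rotated backwards. The sign in the rotation disappears
  since morphisms out of a zero object are unique.\<close>

lemma dist_tri_ident_left: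
  assumes "X \<in> obj T" "is_zero_obj T Z"
  shows "dist_tri T Z X X (hzero T Z X) (ident T X) (hzero T X (sobj T Z))"
proof -
  have z: "is_zero_obj T (sobj T Z)" "Z \<in> obj T"
    using assms by (auto intro: zero_obj_shift zero_obj_obj)
  have "hneg T (smor T (hzero T Z X)) = hzero T (sobj T Z) (sobj T X)"
    by (rule zero_obj_hom(1)[OF z(1)]) (use assms z in \<open>simp add: hom_iff\<close>)
  then show ?thesis
    using tri_rotate[of "hzero T Z X" Z X "ident T X" X "hzero T X (sobj T Z)"]
      tri_ident[OF assms(1) z(1)] assms z by (simp add: hom_iff)
qed

text \<open>Comparing a triangle with \<open>0 \<rightarrow> W = W \<rightarrow> 0\<close> along \<open>e\<close> makes its second morphism a weak
  cokernel of the first.\<close>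

lemma weak_cokernel:
  assumes d: "dist_tri T X Y Z f g h" and e: "e \<in> hom_set T Y W" "e \<cdot> f = hzero T X W"
  shows "\<exists>k \<in> hom_set T Z W. e = k \<cdot> g"
proof -
  note t = dist_tri_simps[OF d]
  obtain O' where z: "is_zero_obj T O'" using zero_obj_exists by blast
  then have "O' \<in> obj T" by (rule zero_obj_obj)
  have "W \<in> obj T" using e(1) by (rule hom_obj)
  have "\<exists>c \<in> hom_set T Z W. c \<cdot> g = ident T W \<cdot> e \<and>
      smor T (hzero T X O') \<cdot> h = hzero T W (sobj T O') \<cdot> c"
    by (rule tri_morphism[OF d dist_tri_ident_left[OF \<open>W \<in> obj T\<close> z]])
      (use t e \<open>W \<in> obj T\<close> \<open>O' \<in> obj T\<close> in \<open>auto simp: hom_iff\<close>)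
  then obtain c where "c \<in> hom_set T Z W" "c \<cdot> g = ident T W \<cdot> e" by blast
  then show ?thesis using e by (auto simp: hom_iff)
qed

lemma weak_cokernel':
  assumes d: "dist_tri T X Y Z f g h" and e: "e \<in> hom_set T Z W" "e \<cdot> g = hzero T Y W"
  shows "\<exists>k \<in> hom_set T (sobj T X) W. e = k \<cdot> h"
  by (rule weak_cokernel[OF dist_tri_rotate[OF d] e])

text \<open>Put \<open>e = x - 1\<close>. Then \<open>e g = 0\<close>, so that \<open>e = k h\<close> for some \<open>k\<close>, and \<open>h e = 0\<close>; hence
  \<open>e e = k h e = 0\<close> and \<open>1 - e\<close> is an inverse of \<open>x = 1 + e\<close>. This replaces the five lemma.\<close>

lemma triangle_endo_invertible:
  assumes g: "g \<in> hom_set T Y Z" and h: "h \<in> hom_set T Z V" and x: "x \<in> hom_set T Z Z"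
    and xg: "x \<cdot> g = g" and hx: "h \<cdot> x = h"
    and coker: "\<And>e. e \<in> hom_set T Z Z \<Longrightarrow> e \<cdot> g = hzero T Y Z \<Longrightarrow> \<exists>k \<in> hom_set T V Z. e = k \<cdot> h"
  shows "\<exists>y \<in> hom_set T Z Z. y \<cdot> x = ident T Z \<and> x \<cdot> y = ident T Z"
proof -
  note t = g[unfolded hom_iff] h[unfolded hom_iff] x[unfolded hom_iff]
  have Z: "Z \<in> obj T" "Y \<in> obj T" "V \<in> obj T" using hom_obj[OF g] hom_obj[OF h] by auto
  define e where "e = x \<boxplus> hneg T (ident T Z)"
  have e: "e \<in> mor T" "src T e = Z" "tgt T e = Z" using t Z by (simp_all add: e_def)
  have xe: "x = e \<boxplus> ident T Z" unfolding e_def using t Z by (subst hadd_assoc) auto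
  have "e \<cdot> g = hzero T Y Z" using t Z by (simp add: e_def xg cmp_hneg)
  then obtain k where k: "k \<in> hom_set T V Z" "e = k \<cdot> h" using coker[of e] e by (auto simp: hom_iff)
  have "h \<cdot> e = hzero T Z V" using t Z by (simp add: e_def hx cmp_hneg)
  then have ee: "e \<cdot> e = hzero T Z Z"
    using k t e Z by (metis (no_types) cmp_assoc_right cmp_hzero hom_iff)
  define y where "y = ident T Z \<boxplus> hneg T e"
  have y: "y \<in> mor T" "src T y = Z" "tgt T y = Z" using e Z by (simp_all add: y_def)
  have *: "e \<boxplus> ident T Z \<boxplus> hneg T e = ident T Z"
    using e Z by (subst hadd_commute) (auto simp flip: hadd_assoc)
  have "e \<cdot> x = e" "x \<cdot> e = e" using e Z by (simp_all add: xe ee)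
  then have "y \<cdot> x = ident T Z" "x \<cdot> y = ident T Z"
    using e Z t * by (simp_all add: y_def cmp_hneg) (simp_all add: xe)
  then show ?thesis using y by (auto simp: hom_iff)
qed

text \<open>The two candidate third terms need only have the weak cokernel property: one of them will be a
  direct sum of two triangles, which is not yet known to be distinguished.\<close>

lemma third_isom:
  assumes g: "g \<in> hom_set T Y Z" "g' \<in> hom_set T Y Z'"
    and h: "h \<in> hom_set T Z V" "h' \<in> hom_set T Z' V"
    and c: "c \<in> hom_set T Z Z'" "c \<cdot> g = g'" "h' \<cdot> c = h"
    and d: "d \<in> hom_set T Z' Z" "d \<cdot> g' = g" "h \<cdot> d = h'"
    and coker: "\<And>e. e \<in> hom_set T Z Z \<Longrightarrow> e \<cdot> g = hzero T Y Z \<Longrightarrow> \<exists>k \<in> hom_set T V Z. e = k \<cdot> h"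
    and coker': "\<And>e. e \<in> hom_set T Z' Z' \<Longrightarrow> e \<cdot> g' = hzero T Y Z' \<Longrightarrow> \<exists>k \<in> hom_set T V Z'. e = k \<cdot> h'"
  shows "is_isom T Z Z' c"
proof -
  note t = g[unfolded hom_iff] h[unfolded hom_iff] c(1)[unfolded hom_iff] d(1)[unfolded hom_iff]
  have "(d \<cdot> c) \<cdot> g = g" using t c d by simp
  moreover have "h \<cdot> (d \<cdot> c) = h"
    using t c d cmp_assoc_right[of c d h] by simp
  moreover have "d \<cdot> c \<in> hom_set T Z Z" using t by (simp add: hom_iff)
  ultimately obtain y where y: "y \<in> hom_set T Z Z" "y \<cdot> (d \<cdot> c) = ident T Z"
    using triangle_endo_invertible[OF g(1) h(1) _ _ _ coker, of "d \<cdot> c"] by blast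
  have "(c \<cdot> d) \<cdot> g' = g'" using t c d by simp
  moreover have "h' \<cdot> (c \<cdot> d) = h'"
    using t c d cmp_assoc_right[of d c h'] by simp
  moreover have "c \<cdot> d \<in> hom_set T Z' Z'" using t by (simp add: hom_iff)
  ultimately obtain y' where y': "y' \<in> hom_set T Z' Z'" "(c \<cdot> d) \<cdot> y' = ident T Z'"
    using triangle_endo_invertible[OF g(2) h(2) _ _ _ coker', of "c \<cdot> d"] by blast
  show ?thesis
    by (rule is_isom_one_sided[of _ _ _ "y \<cdot> d" "d \<cdot> y'"]) (use t y y' in \<open>auto simp: hom_iff\<close>)
qed

lemma dist_tri_third_unique:
  assumes d: "dist_tri T X Y Z f g h" and d': "dist_tri T X Y Z' f g' h'"
  shows "isomorphic T Z Z'"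
proof -
  note t = dist_tri_simps[OF d] dist_tri_simps[OF d']
  have "\<exists>c \<in> hom_set T Z Z'. c \<cdot> g = g' \<cdot> ident T Y \<and> smor T (ident T X) \<cdot> h = h' \<cdot> c"
    by (rule tri_morphism[OF d d']) (use t in \<open>auto simp: hom_iff\<close>)
  then obtain c where c: "c \<in> hom_set T Z Z'" "c \<cdot> g = g'" "h' \<cdot> c = h"
    using t by (auto simp: smor_ident)
  have "\<exists>e \<in> hom_set T Z' Z. e \<cdot> g' = g \<cdot> ident T Y \<and> smor T (ident T X) \<cdot> h' = h \<cdot> e"
    by (rule tri_morphism[OF d' d]) (use t in \<open>auto simp: hom_iff\<close>)
  then obtain e where e: "e \<in> hom_set T Z' Z" "e \<cdot> g' = g" "h \<cdot> e = h'"
    using t by (auto simp: smor_ident)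
  have "is_isom T Z Z' c"
    by (rule third_isom[OF _ _ _ _ c e weak_cokernel'[OF d] weak_cokernel'[OF d']])
      (use t in \<open>auto simp: hom_iff\<close>)
  then show ?thesis using t by (auto simp: isomorphic_def)
qed

text \<open>The inclusions of the two triangles induce a comparison from the sum of the cones to the
  cone of the sum, and the projections induce one in the opposite direction. Both respect the
  neighbouring terms, so that they are isomorphisms.\<close>

lemma dist_tri_sum:
  assumes bX: "is_biproduct T X X' X'' iX jX pX qX"
    and bY: "is_biproduct T Y Y' Y'' iY jY pY qY"
    and bZ: "is_biproduct T Z Z' Z'' iZ jZ pZ qZ"
    and d: "dist_tri T X Y Z f g h" and d': "dist_tri T X' Y' Z' f' g' h'"
  shows "\<exists>g'' h''. dist_tri T X'' Y'' Z'' (iY \<cdot> (f \<cdot> pX) \<boxplus> jY \<cdot> (f' \<cdot> qX)) g'' h''"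
proof -
  note t = dist_tri_simps[OF d] dist_tri_simps[OF d'] biproduct_simps[OF bX] biproduct_simps[OF bY]
    biproduct_simps[OF bZ]
  note bS = biproduct_shift[OF bX]
  note s = biproduct_simps[OF bS]
  define F where "F = iY \<cdot> (f \<cdot> pX) \<boxplus> jY \<cdot> (f' \<cdot> qX)"
  have F: "F \<in> hom_set T X'' Y''" using t by (simp add: F_def hom_iff)
  obtain C G H where D: "dist_tri T X'' Y'' C F G H" using tri_cone[OF F] by blast
  note tt = t dist_tri_simps[OF D]
  define g'' where "g'' = iZ \<cdot> (g \<cdot> pY) \<boxplus> jZ \<cdot> (g' \<cdot> qY)"
  define h'' where "h'' = smor T iX \<cdot> (h \<cdot> pZ) \<boxplus> smor T jX \<cdot> (h' \<cdot> qZ)"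
  have g'': "g'' \<in> hom_set T Y'' Z''" using t by (simp add: g''_def hom_iff)
  have h'': "h'' \<in> hom_set T Z'' (sobj T X'')" using t by (simp add: h''_def hom_iff)
  have "\<exists>c1 \<in> hom_set T Z C. c1 \<cdot> g = G \<cdot> iY \<and> smor T iX \<cdot> h = H \<cdot> c1"
    by (rule tri_morphism[OF d D]) (use t F in \<open>auto simp: hom_iff F_def\<close>)
  then obtain c1 where c1: "c1 \<in> hom_set T Z C" "c1 \<cdot> g = G \<cdot> iY" "smor T iX \<cdot> h = H \<cdot> c1"
    by blast
  have "\<exists>c2 \<in> hom_set T Z' C. c2 \<cdot> g' = G \<cdot> jY \<and> smor T jX \<cdot> h' = H \<cdot> c2"
    by (rule tri_morphism[OF d' D]) (use t F in \<open>auto simp: hom_iff F_def\<close>)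
  then obtain c2 where c2: "c2 \<in> hom_set T Z' C" "c2 \<cdot> g' = G \<cdot> jY" "smor T jX \<cdot> h' = H \<cdot> c2"
    by blast
  have "\<exists>d1 \<in> hom_set T C Z. d1 \<cdot> G = g \<cdot> pY \<and> smor T pX \<cdot> H = h \<cdot> d1"
    by (rule tri_morphism[OF D d]) (use t F in \<open>auto simp: hom_iff F_def\<close>)
  then obtain d1 where d1: "d1 \<in> hom_set T C Z" "d1 \<cdot> G = g \<cdot> pY" "smor T pX \<cdot> H = h \<cdot> d1"
    by blast
  have "\<exists>d2 \<in> hom_set T C Z'. d2 \<cdot> G = g' \<cdot> qY \<and> smor T qX \<cdot> H = h' \<cdot> d2"
    by (rule tri_morphism[OF D d']) (use t F in \<open>auto simp: hom_iff F_def\<close>)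
  then obtain d2 where d2: "d2 \<in> hom_set T C Z'" "d2 \<cdot> G = g' \<cdot> qY" "smor T qX \<cdot> H = h' \<cdot> d2"
    by blast
  note ct = c1(1)[unfolded hom_iff] c2(1)[unfolded hom_iff] d1(1)[unfolded hom_iff]
    d2(1)[unfolded hom_iff]
  define c where "c = c1 \<cdot> pZ \<boxplus> c2 \<cdot> qZ"
  have c: "c \<in> hom_set T Z'' C" using ct t by (simp add: c_def hom_iff)
  define r where "r = iZ \<cdot> d1 \<boxplus> jZ \<cdot> d2"
  have r: "r \<in> hom_set T C Z''" using ct t by (simp add: r_def hom_iff)
  have "c \<cdot> g'' = c1 \<cdot> (g \<cdot> pY) \<boxplus> c2 \<cdot> (g' \<cdot> qY)"
    using ct t by (simp add: c_def g''_def)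
  also have "\<dots> = G \<cdot> (iY \<cdot> pY) \<boxplus> G \<cdot> (jY \<cdot> qY)"
    using ct tt by (simp add: cmp_reassoc[OF c1(2)] cmp_reassoc[OF c2(2)])
  also have "\<dots> = G" using tt by (intro biproduct_sum(3)[OF bY]) auto
  finally have cg: "c \<cdot> g'' = G" .
  have "H \<cdot> c = (H \<cdot> c1) \<cdot> pZ \<boxplus> (H \<cdot> c2) \<cdot> qZ" using ct tt by (simp add: c_def)
  also have "\<dots> = h''" using ct tt by (simp add: c1(3)[symmetric] c2(3)[symmetric] h''_def)
  finally have Hc: "H \<cdot> c = h''" .
  have rG: "r \<cdot> G = g''" using ct tt by (simp add: r_def d1 d2 g''_def)
  have "h'' \<cdot> r = smor T iX \<cdot> (h \<cdot> d1) \<boxplus> smor T jX \<cdot> (h' \<cdot> d2)"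
    using ct tt by (simp add: h''_def r_def)
  also have "\<dots> = smor T iX \<cdot> (smor T pX \<cdot> H) \<boxplus> smor T jX \<cdot> (smor T qX \<cdot> H)"
    by (simp add: d1 d2)
  also have "\<dots> = H" using tt by (intro biproduct_sum(2)[OF bS]) auto
  finally have hr: "h'' \<cdot> r = H" .
  \<comment> \<open>the two restrictions of \<open>e\<close> factor through \<open>h\<close> and \<open>h'\<close>, hence \<open>e\<close> through their sum\<close>
  have coker: "\<exists>k \<in> hom_set T (sobj T X'') Z''. e = k \<cdot> h''"
    if e: "e \<in> hom_set T Z'' Z''" and eg: "e \<cdot> g'' = hzero T Y'' Z''" for e
  proof -
    note et = e[unfolded hom_iff]
    have "(e \<cdot> iZ) \<cdot> g = (e \<cdot> g'') \<cdot> iY" using et t by (simp add: g''_def)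
    then have "(e \<cdot> iZ) \<cdot> g = hzero T Y Z''" using t eg by simp
    then obtain k where k: "k \<in> hom_set T (sobj T X) Z''" "e \<cdot> iZ = k \<cdot> h"
      using weak_cokernel'[OF d, of "e \<cdot> iZ"] et t by (auto simp: hom_iff)
    have "(e \<cdot> jZ) \<cdot> g' = (e \<cdot> g'') \<cdot> jY" using et t by (simp add: g''_def)
    then have "(e \<cdot> jZ) \<cdot> g' = hzero T Y' Z''" using t eg by simp
    then obtain k' where k': "k' \<in> hom_set T (sobj T X') Z''" "e \<cdot> jZ = k' \<cdot> h'"
      using weak_cokernel'[OF d', of "e \<cdot> jZ"] et t
      by (auto simp: hom_iff)
    note kt = k(1)[unfolded hom_iff] k'(1)[unfolded hom_iff]
    have "(k \<cdot> smor T pX \<boxplus> k' \<cdot> smor T qX) \<cdot> h'' = k \<cdot> (h \<cdot> pZ) \<boxplus> k' \<cdot> (h' \<cdot> qZ)"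
      using kt t s(16-) by (simp add: h''_def)
    also have "\<dots> = e \<cdot> (iZ \<cdot> pZ) \<boxplus> e \<cdot> (jZ \<cdot> qZ)"
      using kt et t by (simp add: cmp_reassoc[OF k(2)[symmetric]] cmp_reassoc[OF k'(2)[symmetric]])
    also have "\<dots> = e" using et by (intro biproduct_sum(3)[OF bZ]) auto
    finally show ?thesis using kt t
      by (intro bexI[of _ "k \<cdot> smor T pX \<boxplus> k' \<cdot> smor T qX"]) (auto simp: hom_iff)
  qed
  have iso: "is_isom T C Z'' r"
    by (rule third_isom[OF _ g'' _ h'' r rG hr c cg Hc weak_cokernel'[OF D] coker])
      (use tt in \<open>simp_all add: hom_iff\<close>)
  have "dist_tri T X'' Y'' Z'' F g'' h''"
  proof (rule tri_iso[OF D F g'' h'' _ _ iso])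
    show "is_isom T X'' X'' (ident T X'')" "is_isom T Y'' Y'' (ident T Y'')" using t by auto
    show "ident T Y'' \<cdot> F = F \<cdot> ident T X''" using F by (simp add: hom_iff)
    show "r \<cdot> G = g'' \<cdot> ident T Y''" using g'' rG by (simp add: hom_iff)
    show "smor T (ident T X'') \<cdot> H = h'' \<cdot> r" using tt by (simp add: hr smor_ident)
  qed
  then show ?thesis unfolding F_def by blast
qed

subsection \<open>Triangles of objects\<close>

text \<open>The existence of a triangle on three given objects is invariant under isomorphism, and it is
  all that matters once no particular morphism is prescribed.\<close>

definition triangle :: "'o \<Rightarrow> 'o \<Rightarrow> 'o \<Rightarrow> bool" where
  "triangle X Y Z \<longleftrightarrow> (\<exists>f g h. dist_tri T X Y Z f g h)"

lemma triangleI: "dist_tri T X Y Z f g h \<Longrightarrow> triangle X Y Z"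
  by (auto simp: triangle_def)

lemma triangle_obj:
  assumes "triangle X Y Z" shows "X \<in> obj T" "Y \<in> obj T" "Z \<in> obj T"
  using assms dist_tri_simps(10-12) by (auto simp: triangle_def)

lemma triangle_rotate: "triangle X Y Z \<Longrightarrow> triangle Y Z (sobj T X)"
  unfolding triangle_def using dist_tri_rotate by blast

lemma triangle_iso:
  assumes "triangle X Y Z" "isomorphic T X X'" "isomorphic T Y Y'" "isomorphic T Z Z'"
  shows "triangle X' Y' Z'"
proof -
  obtain f g h where d: "dist_tri T X Y Z f g h" using assms by (auto simp: triangle_def)
  obtain a where a0: "is_isom T X X' a" using assms by (auto simp: isomorphic_def)
  then obtain a' where a: "a \<in> hom_set T X X'" "a' \<in> hom_set T X' X" "a' \<cdot> a = ident T X"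
    by (rule is_isomE)
  obtain b where b0: "is_isom T Y Y' b" using assms by (auto simp: isomorphic_def)
  then obtain b' where b: "b \<in> hom_set T Y Y'" "b' \<in> hom_set T Y' Y" "b' \<cdot> b = ident T Y"
    by (rule is_isomE)
  obtain c where c0: "is_isom T Z Z' c" using assms by (auto simp: isomorphic_def)
  then obtain c' where c: "c \<in> hom_set T Z Z'" "c' \<in> hom_set T Z' Z" "c' \<cdot> c = ident T Z"
    by (rule is_isomE)
  note t = dist_tri_simps[OF d] a[unfolded hom_iff] b[unfolded hom_iff] c[unfolded hom_iff]
  have "dist_tri T X' Y' Z' (b \<cdot> (f \<cdot> a')) (c \<cdot> (g \<cdot> b')) (smor T a \<cdot> (h \<cdot> c'))"
    by (rule tri_iso[OF d _ _ _ a0 b0 c0]) (use t in \<open>auto simp: hom_iff\<close>)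
  then show ?thesis by (rule triangleI)
qed

lemma triangle_zero_left:
  assumes "X \<in> obj T" "is_zero_obj T Z" shows "triangle Z X X"
  using dist_tri_ident_left[OF assms] by (rule triangleI)

lemma triangle_zero_right:
  assumes "X \<in> obj T" "is_zero_obj T Z" shows "triangle X X Z"
  using tri_ident[OF assms] by (rule triangleI)

lemma triangle_zero_mid:
  assumes "X \<in> obj T" "is_zero_obj T Z" shows "triangle X Z (sobj T X)"
  by (rule triangle_rotate[OF triangle_zero_right[OF assms]])

lemma triangle_zero_iso:
  assumes "triangle Z X Y" "is_zero_obj T Z" shows "isomorphic T X Y"
proof -
  obtain f g h where d: "dist_tri T Z X Y f g h" using assms by (auto simp: triangle_def)
  note t = dist_tri_simps[OF d]
  have "f = hzero T Z X" by (rule zero_obj_hom(1)[OF assms(2)]) (use t in \<open>auto simp: hom_iff\<close>)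
  then show ?thesis
    using dist_tri_third_unique[OF dist_tri_ident_left[OF t(11) assms(2)]] d by blast
qed

lemma triangle_sum:
  assumes "is_dsum T X X' X''" "is_dsum T Y Y' Y''" "is_dsum T Z Z' Z''"
    and "triangle X Y Z" "triangle X' Y' Z'"
  shows "triangle X'' Y'' Z''"
proof -
  obtain i j p q where b: "is_biproduct T X X' X'' i j p q" using assms(1) by (rule is_dsumE)
  obtain i1 j1 p1 q1 where b1: "is_biproduct T Y Y' Y'' i1 j1 p1 q1" using assms(2) by (rule is_dsumE)
  obtain i2 j2 p2 q2 where b2: "is_biproduct T Z Z' Z'' i2 j2 p2 q2" using assms(3) by (rule is_dsumE)
  obtain f g h where d: "dist_tri T X Y Z f g h" using assms(4) by (auto simp: triangle_def)
  obtain f' g' h' where d': "dist_tri T X' Y' Z' f' g' h'" using assms(5) by (auto simp: triangle_def)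
  show ?thesis using dist_tri_sum[OF b b1 b2 d d'] unfolding triangle_def by blast
qed

lemma is_dsum_zero_right: "A \<in> obj T \<Longrightarrow> is_zero_obj T Z \<Longrightarrow> is_dsum T A Z A"
  by (blast intro: is_dsumI biproduct_zero_right)

text \<open>It is the direct sum of the triangles \<open>A = A \<rightarrow> 0\<close> and \<open>0 \<rightarrow> B = B\<close>.\<close>

lemma triangle_split:
  assumes "is_dsum T A B W" shows "triangle A W B"
proof -
  obtain Z where Z: "is_zero_obj T Z" using zero_obj_exists by blast
  show ?thesis
    by (rule triangle_sum[OF is_dsum_zero_right[OF _ Z] assms
          is_dsum_commute[OF is_dsum_zero_right[OF _ Z]]])
      (use is_dsum_obj[OF assms] Z in \<open>auto intro: triangle_zero_left triangle_zero_right\<close>)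
qed

text \<open>Since the shift is full, the last two morphisms, up to sign, are shifts of morphisms
  \<open>a\<close> and \<open>b\<close>, and the rotation axiom can be applied backwards twice.\<close>

lemma dist_tri_unrotate:
  assumes "dist_tri T Z (sobj T X) (sobj T Y) c a' b'" "X \<in> obj T" "Y \<in> obj T"
  obtains a b where "dist_tri T X Y Z a b c"
proof -
  note t = dist_tri_simps[OF assms(1)]
  obtain a where a: "a \<in> hom_set T X Y" "smor T a = hneg T a'"
    using smor_fullE[of "hneg T a'" X Y] t assms by (auto simp: hom_iff)
  obtain b where b: "b \<in> hom_set T Y Z" "smor T b = hneg T b'"
    using smor_fullE[of "hneg T b'" Y Z] t assms by (auto simp: hom_iff)
  have c: "c \<in> hom_set T Z (sobj T X)" using t by (simp add: hom_iff)
  have sa: "hneg T (smor T a) = a'" "hneg T (smor T b) = b'" using a b t by auto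
  have "dist_tri T Y Z (sobj T X) b c (hneg T (smor T a))"
    using tri_rotate[of b Y Z c "sobj T X" a'] assms(1) a b c sa t by (simp add: hom_iff)
  then show ?thesis using tri_rotate[OF a(1) b(1) c] that by blast
qed

lemma triangle_unrotate:
  assumes "triangle Z (sobj T X) (sobj T Y)" "X \<in> obj T" "Y \<in> obj T"
  shows "triangle X Y Z"
  using assms dist_tri_unrotate unfolding triangle_def by metis

lemma triangle_unshift:
  assumes "triangle (sobj T X) (sobj T Y) (sobj T Z)" "X \<in> obj T" "Y \<in> obj T" "Z \<in> obj T"
  shows "triangle X Y Z"
proof -
  obtain f g h where d: "dist_tri T (sobj T X) (sobj T Y) (sobj T Z) f g h"
    using assms by (auto simp: triangle_def)
  obtain a b where ab: "dist_tri T Y Z (sobj T X) a b f"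
    using dist_tri_unrotate[OF d assms(3,4)] by blast
  note t = dist_tri_simps[OF ab]
  obtain f' where f': "f' \<in> hom_set T X Y" "smor T f' = hneg T f"
    using smor_fullE[of "hneg T f" X Y] t assms by (auto simp: hom_iff)
  have "dist_tri T X Y Z f' a b"
    using tri_rotate[OF f'(1), of a Z b] ab f' t by (simp add: hom_iff)
  then show ?thesis by (rule triangleI)
qed

lemma octahedron_left:
  assumes "triangle A X X'" "triangle X Z Y"
  obtains W where "triangle A Z W" "triangle X' W Y"
proof -
  obtain f a a' where d: "dist_tri T A X X' f a a'" using assms by (auto simp: triangle_def)
  obtain g b b' where e: "dist_tri T X Z Y g b b'" using assms by (auto simp: triangle_def)
  obtain W c c' where w: "dist_tri T A Z W (g \<cdot> f) c c'"
    using tri_cone[of "g \<cdot> f" A Z] dist_tri_simps[OF d] dist_tri_simps[OF e] by (auto simp: hom_iff)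
  show ?thesis using tri_octahedral[OF d e w] that triangleI w by metis
qed

text \<open>The octahedron over \<open>A \<rightarrow> M \<rightarrow> X[1]\<close>, read with fibres in place of cones.\<close>

lemma octahedron_right:
  assumes "triangle X Y M" "triangle A M M'"
  obtains W where "triangle X W A" "triangle W Y M'"
proof -
  obtain V where V: "triangle A (sobj T X) V" "triangle M' V (sobj T Y)"
    using octahedron_left[OF assms(2) triangle_rotate[OF triangle_rotate[OF assms(1)]]] by blast
  have "V \<in> obj T" using triangle_obj[OF V(1)] by blast
  define W where "W = unshift T V"
  have W: "W \<in> obj T" "isomorphic T V (sobj T W)"
    using unshift_obj_iso[OF \<open>V \<in> obj T\<close>] by (auto simp: W_def intro: isomorphic_sym)
  note o = triangle_obj[OF assms(1)] triangle_obj[OF assms(2)]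
  have "triangle A (sobj T X) (sobj T W)"
    by (rule triangle_iso[OF V(1)]) (use o W in auto)
  moreover have "triangle M' (sobj T W) (sobj T Y)"
    by (rule triangle_iso[OF V(2)]) (use o W in auto)
  ultimately show ?thesis using that triangle_unrotate o W by blast
qed

end

section \<open>Filtrations and generated triangulated subcategories\<close>

text \<open>The successive factors are added on the right; this is the direction in which the telescoping
  construction below proceeds.\<close>

inductive_set filtered :: "('o, 'm, 'z) tricat_scheme \<Rightarrow> 'o set \<Rightarrow> 'o set"
  for T :: "('o, 'm, 'z) tricat_scheme" and V :: "'o set" where
  zero: "is_zero_obj T M \<Longrightarrow> M \<in> filtered T V"
| extend: "M \<in> filtered T V \<Longrightarrow> A \<in> V \<Longrightarrow> dist_tri T M M' A f g h \<Longrightarrow> M' \<in> filtered T V"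

text \<open>Negative shifts are determined only up to isomorphism, so the closure under isomorphism is
  needed for closure under the shift and its inverse.\<close>

definition shift_closure :: "('o, 'm, 'z) tricat_scheme \<Rightarrow> 'o set \<Rightarrow> 'o set" where
  "shift_closure T U = {X. \<exists>A \<in> U. \<exists>r. isomorphic T X (shift T r A)}"

context triangulated_category
begin

subsection \<open>Iterated shifts\<close>

lemma shift_0 [simp]: "shift T 0 X = X"
  by (simp add: shift_def)

lemma shift_1 [simp]: "shift T 1 X = sobj T X"
  by (simp add: shift_def)

lemma shift_minus_1 [simp]: "shift T (- 1) X = unshift T X"
  by (simp add: shift_def)

lemma shift_obj: "X \<in> obj T \<Longrightarrow> shift T r X \<in> obj T"
proof -
  assume X: "X \<in> obj T"
  have "(sobj T ^^ n) X \<in> obj T" "(unshift T ^^ n) X \<in> obj T" for n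
    using X by (induction n) (auto intro: unshift_obj_iso)
  then show ?thesis by (simp add: shift_def)
qed

lemma shift_succ:
  assumes "X \<in> obj T" shows "isomorphic T (sobj T (shift T r X)) (shift T (r + 1) X)"
proof (cases "0 \<le> r")
  case True
  then have "shift T (r + 1) X = sobj T (shift T r X)"
    by (simp add: shift_def nat_add_distrib)
  then show ?thesis using shift_obj[OF assms] by simp
next
  case False
  then have n: "nat (- r) = Suc (nat (- (r + 1)))" by simp
  have "shift T r X = unshift T (shift T (r + 1) X)"
  proof (cases "r = - 1")
    case False
    then have "\<not> 0 \<le> r + 1" using \<open>\<not> 0 \<le> r\<close> by simp
    then show ?thesis using \<open>\<not> 0 \<le> r\<close> n by (simp add: shift_def)
  qed simp
  then show ?thesis using unshift_obj_iso[OF shift_obj[OF assms]] by simp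
qed

lemma shift_shift:
  assumes "X \<in> obj T" shows "isomorphic T (shift T r (shift T m X)) (shift T (r + m) X)"
proof (induction r rule: int_induct[where k = 0])
  case base
  then show ?case using shift_obj[OF assms] by simp
next
  note [trans] = isomorphic_trans
  case (step1 r)
  have "isomorphic T (shift T (r + 1) (shift T m X)) (sobj T (shift T r (shift T m X)))"
    by (intro isomorphic_sym[OF shift_succ] shift_obj assms)
  also have "isomorphic T \<dots> (sobj T (shift T (r + m) X))"
    by (rule isomorphic_shift[OF step1(2)])
  also have "isomorphic T \<dots> (shift T (r + 1 + m) X)"
    using shift_succ[OF assms, of "r + m"] by (simp add: algebra_simps)
  finally show ?case .
next
  note [trans] = isomorphic_trans
  case (step2 r)
  have "isomorphic T (sobj T (shift T (r - 1) (shift T m X))) (shift T r (shift T m X))"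
    using shift_succ[OF shift_obj[OF assms], of "r - 1" m] by simp
  also note step2(2)
  also have "isomorphic T (shift T (r + m) X) (sobj T (shift T (r - 1 + m) X))"
    using shift_succ[OF assms, of "r - 1 + m"] by (simp add: algebra_simps isomorphic_sym)
  finally show ?case by (rule isomorphic_shift_cancel) (intro shift_obj assms)+
qed

text \<open>Any direct sum of \<open>A\<close> and \<open>B\<close> becomes isomorphic to \<open>W\<close> after shifting.\<close>

lemma is_dsum_shift_cancel:
  assumes "is_dsum T (sobj T A) (sobj T B) (sobj T W)" "A \<in> obj T" "B \<in> obj T" "W \<in> obj T"
  shows "is_dsum T A B W"
proof -
  obtain V where V: "is_dsum T A B V" using dsum_exists[OF assms(2,3)] by blast
  have "isomorphic T V W"
    using is_dsum_unique[OF is_dsum_shift[OF V] assms(1)] is_dsum_obj(3)[OF V] assms(4)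
    by (rule isomorphic_shift_cancel)
  then show ?thesis
    using is_dsum_iso[OF V isomorphic_refl isomorphic_refl] assms(2,3) by blast
qed

lemma is_dsum_shift_int:
  assumes "is_dsum T A B W" shows "is_dsum T (shift T r A) (shift T r B) (shift T r W)"
proof (induction r rule: int_induct[where k = 0])
  case base
  then show ?case using assms by simp
next
  case (step1 r)
  show ?case
    by (rule is_dsum_iso[OF is_dsum_shift[OF step1(2)]]; intro shift_succ is_dsum_obj[OF assms])
next
  case (step2 r)
  have *: "isomorphic T (shift T r X) (sobj T (shift T (r - 1) X))" if "X \<in> obj T" for X
    using isomorphic_sym[OF shift_succ[OF that, of "r - 1"]] by simp
  show ?case
    by (rule is_dsum_shift_cancel[OF is_dsum_iso[OF step2(2)]])
      (intro * shift_obj is_dsum_obj[OF assms])+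
qed

lemma shift_closure_shift:
  assumes "U \<subseteq> obj T" "X \<in> shift_closure T U" shows "sobj T X \<in> shift_closure T U"
proof -
  obtain A r where A: "A \<in> U" "isomorphic T X (shift T r A)"
    using assms by (auto simp: shift_closure_def)
  then have "isomorphic T (sobj T X) (shift T (r + 1) A)"
    using assms by (blast intro: isomorphic_trans[OF isomorphic_shift shift_succ])
  then show ?thesis using A by (auto simp: shift_closure_def)
qed

lemma shift_closure_unshift:
  assumes "U \<subseteq> obj T" "isomorphic T (sobj T Y) X" "X \<in> shift_closure T U" "Y \<in> obj T"
  shows "Y \<in> shift_closure T U"
proof -
  obtain A r where A: "A \<in> U" "isomorphic T X (shift T r A)"
    using assms by (auto simp: shift_closure_def)
  then have "A \<in> obj T" using assms by auto
  have "isomorphic T (shift T r A) (sobj T (shift T (r - 1) A))"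
    using isomorphic_sym[OF shift_succ[OF \<open>A \<in> obj T\<close>, of "r - 1"]] by simp
  then have "isomorphic T (sobj T Y) (sobj T (shift T (r - 1) A))"
    using A(2) assms(2) by (blast intro: isomorphic_trans)
  then have "isomorphic T Y (shift T (r - 1) A)"
    by (rule isomorphic_shift_cancel) (use assms shift_obj \<open>A \<in> obj T\<close> in auto)
  then show ?thesis using A by (auto simp: shift_closure_def)
qed

lemma subset_shift_closure:
  assumes "U \<subseteq> obj T" shows "U \<subseteq> shift_closure T U"
proof
  fix X assume "X \<in> U"
  then have "isomorphic T X (shift T 0 X)" using assms by auto
  then show "X \<in> shift_closure T U" using \<open>X \<in> U\<close> unfolding shift_closure_def by blast
qed

subsection \<open>Objects with a filtration\<close>

lemma filtered_obj: "M \<in> filtered T V \<Longrightarrow> M \<in> obj T"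
  by (induction rule: filtered.induct) (auto simp: zero_obj_obj dist_tri_simps)

lemma filtered_extend: "M \<in> filtered T V \<Longrightarrow> A \<in> V \<Longrightarrow> triangle M M' A \<Longrightarrow> M' \<in> filtered T V"
  by (auto simp: triangle_def intro: filtered.extend)

lemma triangle_zero_right_iso:
  assumes "triangle X Y Z" "is_zero_obj T Z" shows "isomorphic T X Y"
proof -
  have "triangle Z (sobj T X) (sobj T Y)" by (intro triangle_rotate assms(1))
  then have "isomorphic T (sobj T X) (sobj T Y)" using assms(2) by (rule triangle_zero_iso)
  then show ?thesis by (rule isomorphic_shift_cancel) (use triangle_obj[OF assms(1)] in auto)
qed

lemma filtered_iso:
  assumes "M \<in> filtered T V" "isomorphic T M N" shows "N \<in> filtered T V"
  using assms
proof (cases rule: filtered.cases)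
  case zero
  show ?thesis by (rule filtered.zero[OF zero_obj_iso[OF zero assms(2)]])
next
  case (extend M' A f g h)
  then have "triangle M' N A"
    using dist_tri_simps[OF extend(3)] assms(2) by (intro triangle_iso[OF triangleI[OF extend(3)]]) auto
  then show ?thesis using extend filtered_extend by blast
qed

text \<open>Induction on the filtration of the right-hand term: the octahedral axiom detaches its last
  factor, which becomes the last factor of \<open>Z\<close>.\<close>

lemma filtered_extension:
  assumes "Y \<in> filtered T V" "X \<in> filtered T V" "triangle X Z Y"
  shows "Z \<in> filtered T V"
  using assms
proof (induction arbitrary: Z rule: filtered.induct)
  case (zero Y)
  show ?case
    by (rule filtered_iso[OF zero(2) triangle_zero_right_iso[OF zero(3,1)]])
next
  case (extend Y' A Y f g h)
  obtain W where "triangle X W Y'" "triangle W Z A"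
    using octahedron_right[OF extend.prems(2) triangleI[OF extend.hyps(3)]] by blast
  then show ?case using extend by (blast intro: filtered_extend)
qed

lemma filtered_shift:
  assumes "M \<in> filtered T V" "\<And>A. A \<in> V \<Longrightarrow> sobj T A \<in> V"
  shows "sobj T M \<in> filtered T V"
  using assms(1)
proof (induction rule: filtered.induct)
  case (zero M)
  show ?case by (rule filtered.zero[OF zero_obj_shift[OF zero]])
next
  case (extend M A M' f g h)
  have "triangle (sobj T M) (sobj T M') (sobj T A)"
    by (intro triangle_rotate triangleI[OF extend.hyps(3)])
  then show ?case using extend assms(2) by (blast intro: filtered_extend)
qed

text \<open>The shift reflects triangles, so the whole filtration can be shifted back.\<close>

lemma filtered_unshift:
  assumes "M \<in> filtered T V" "isomorphic T (sobj T N) M" "N \<in> obj T"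
    and V: "\<And>A B. A \<in> V \<Longrightarrow> isomorphic T (sobj T B) A \<Longrightarrow> B \<in> obj T \<Longrightarrow> B \<in> V"
  shows "N \<in> filtered T V"
  using assms(1-3)
proof (induction arbitrary: N rule: filtered.induct)
  case (zero M)
  have "is_zero_obj T (sobj T N)"
    by (rule zero_obj_iso[OF zero(1) isomorphic_sym[OF zero(2)]])
  then have "isomorphic T (sobj T M) (sobj T N)"
    by (rule zero_obj_isomorphic[OF zero_obj_shift[OF zero(1)]])
  then have "isomorphic T M N"
    using zero_obj_obj[OF zero(1)] zero(3) by (rule isomorphic_shift_cancel)
  then show ?case by (rule filtered.zero[OF zero_obj_iso[OF zero(1)]])
next
  case (extend M A M' f g h)
  note o = dist_tri_simps(10-12)[OF extend.hyps(3)]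
  note u = unshift_obj_iso[OF o(1)] unshift_obj_iso[OF o(3)]
  have "triangle (sobj T (unshift T M)) (sobj T N) (sobj T (unshift T A))"
    by (rule triangle_iso[OF triangleI[OF extend.hyps(3)]]; rule isomorphic_sym)
      (use u extend in auto)
  then have "triangle (unshift T M) N (unshift T A)"
    by (rule triangle_unshift) (use u extend in auto)
  then show ?case using extend.IH[OF u(2,1)] V[OF extend.hyps(2) u(4,3)] by (blast intro: filtered_extend)
qed

lemma triangulated_subcategory_filtered:
  assumes V: "\<And>A. A \<in> V \<Longrightarrow> sobj T A \<in> V"
    "\<And>A B. A \<in> V \<Longrightarrow> isomorphic T (sobj T B) A \<Longrightarrow> B \<in> obj T \<Longrightarrow> B \<in> V"
  shows "triangulated_subcategory T (filtered T V)"
  unfolding triangulated_subcategory_def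
proof (intro conjI allI ballI impI)
  show "filtered T V \<subseteq> obj T" using filtered_obj by blast
  show "Y \<in> filtered T V" if "X \<in> filtered T V" "isomorphic T X Y" for X Y
    using that by (rule filtered_iso)
  show "shift T 1 X \<in> filtered T V" "shift T (- 1) X \<in> filtered T V" if "X \<in> filtered T V" for X
    using filtered_shift[OF that V(1)] filtered_unshift[OF that _ _ V(2)]
      unshift_obj_iso[OF filtered_obj[OF that]] by auto
  show "Z \<in> filtered T V"
    if "dist_tri T X Y Z f g h" "X \<in> filtered T V" "Y \<in> filtered T V" for X Y Z f g h
    using filtered_extension[OF filtered_shift[OF that(2) V(1)] that(3)]
      triangle_rotate[OF triangleI[OF that(1)]] by blast
qed (rule filtered.zero)

lemma tria_subset_filtered:
  assumes "U \<subseteq> obj T" shows "tria T U \<subseteq> filtered T (shift_closure T U)"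
proof -
  let ?V = "shift_closure T U"
  have "triangulated_subcategory T (filtered T ?V)"
    by (rule triangulated_subcategory_filtered)
      (use assms shift_closure_shift shift_closure_unshift in blast)+
  moreover have "U \<subseteq> filtered T ?V"
  proof
    fix X assume X: "X \<in> U"
    obtain Z where Z: "is_zero_obj T Z" using zero_obj_exists by blast
    have "triangle Z X X" using X Z assms by (intro triangle_zero_left) auto
    moreover have "X \<in> ?V" using X subset_shift_closure[OF assms] by blast
    ultimately show "X \<in> filtered T ?V" using filtered.zero[OF Z] by (blast intro: filtered_extend)
  qed
  ultimately show ?thesis unfolding tria_def by blast
qed

lemma filtered_mono: "M \<in> filtered T V \<Longrightarrow> V \<subseteq> V' \<Longrightarrow> M \<in> filtered T V'"
  by (induction rule: filtered.induct) (auto intro: filtered.intros)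

text \<open>The powers \<^const>\<open>star_power\<close> build an object by adding factors on the left, whereas a
  filtration adds them on the right. The octahedral axiom moves a new right factor past the
  outermost left one.\<close>

lemma star_power_extend:
  assumes "M \<in> star_power T U n" "triangle M M' A" "A \<in> U"
  shows "M' \<in> star_power T U (Suc n)"
  using assms(1,2)
proof (induction n arbitrary: M M')
  case 0
  then have z: "is_zero_obj T M" by simp
  note o = triangle_obj[OF 0(2)]
  have "isomorphic T A M'" by (rule isomorphic_sym[OF triangle_zero_iso[OF 0(2) z]])
  then have "triangle A M' M"
    using o by (intro triangle_iso[OF triangle_zero_right[OF o(3) z]]) auto
  then show ?case using z assms(3) o unfolding triangle_def star_def star_power.simps by blast
next
  case (Suc n)
  obtain B C where B: "B \<in> U" "C \<in> star_power T U n" "triangle B M C"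
    using Suc.prems(1) unfolding star_power.simps star_def triangle_def by blast
  obtain W where W: "triangle B M' W" "triangle C W A"
    using octahedron_left[OF B(3) Suc.prems(2)] by blast
  then have "W \<in> star_power T U (Suc n)" using Suc.IH[OF B(2)] by blast
  then show ?case using B(1) W(1) triangle_obj[OF W(1)]
    unfolding star_power.simps(2)[of T U "Suc n"] star_def triangle_def by blast
qed

lemma filtered_subset_extension_closure:
  assumes "M \<in> filtered T U" shows "M \<in> extension_closure T U"
  using assms
proof (induction rule: filtered.induct)
  case (zero M)
  then have "M \<in> star_power T U 0" by simp
  then show ?case unfolding extension_closure_def by blast
next
  case (extend M A M' f g h)
  then obtain n where "M \<in> star_power T U n" by (auto simp: extension_closure_def)
  then have "M' \<in> star_power T U (Suc n)"
    using extend.hyps triangleI star_power_extend by blast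
  then show ?case unfolding extension_closure_def by blast
qed

lemma star_power_mono: "U \<subseteq> U' \<Longrightarrow> star_power T U n \<subseteq> star_power T U' n"
  by (induction n) (fastforce simp: star_def)+

section \<open>Telescoping a filtration\<close>

text \<open>Summands may be replaced by isomorphic objects.\<close>

lemma finite_dsums_shift_closure:
  assumes "N \<in> finite_dsums T (shift_closure T U)" shows "N \<in> finite_dsums T (shifts T U)"
  using assms
proof (induction rule: finite_dsums.induct)
  case (zero N)
  then show ?case by (rule finite_dsums.zero)
next
  case (step A B W)
  then obtain A' r where A: "A' \<in> U" "isomorphic T A (shift T r A')"
    by (auto simp: shift_closure_def)
  then have "is_dsum T (shift T r A') B W"
    using is_dsum_obj[OF step.hyps(3)] by (intro is_dsum_iso[OF step.hyps(3)]) auto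
  moreover have "shift T r A' \<in> shifts T U" using A by (auto simp: shifts_def)
  ultimately show ?case using step.IH by (blast intro: finite_dsums.step)
qed

lemma finite_dsums_mono: "N \<in> finite_dsums T V \<Longrightarrow> V \<subseteq> V' \<Longrightarrow> N \<in> finite_dsums T V'"
  by (induction rule: finite_dsums.induct) (auto intro: finite_dsums.intros)

lemma finite_dsums_obj: "N \<in> finite_dsums T V \<Longrightarrow> N \<in> obj T"
  by (induction rule: finite_dsums.induct) (auto simp: zero_obj_obj is_dsum_obj)

text \<open>The reason is \<open>(a p)\<^sup>n\<^sup>+\<^sup>1 = a (p a)\<^sup>n p\<close>.\<close>

lemma nilpotent_endo_cycle:
  assumes a: "a \<in> hom_set T Z W" and p: "p \<in> hom_set T W Z" and nil: "nilpotent_endo T Z (p \<cdot> a)"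
  shows "nilpotent_endo T W (a \<cdot> p)"
proof -
  let ?v = "p \<cdot> a"
  note t = a[unfolded hom_iff] p[unfolded hom_iff]
  have Z: "Z \<in> obj T" "W \<in> obj T" using hom_obj[OF a] by auto
  define P where "P n = ((\<lambda>w. ?v \<cdot> w) ^^ n) (ident T Z)" for n
  have P: "P n \<in> mor T \<and> src T (P n) = Z \<and> tgt T (P n) = Z" for n
    unfolding P_def by (induction n) (use t Z in auto)
  have eq: "((\<lambda>w. (a \<cdot> p) \<cdot> w) ^^ Suc n) (ident T W) = a \<cdot> (P n \<cdot> p)" for n
  proof (induction n)
    case 0
    then show ?case using t Z by (simp add: P_def)
  next
    case (Suc n)
    have "((\<lambda>w. (a \<cdot> p) \<cdot> w) ^^ Suc (Suc n)) (ident T W) = (a \<cdot> p) \<cdot> (a \<cdot> (P n \<cdot> p))"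
      using Suc by simp
    also have "\<dots> = a \<cdot> ((?v \<cdot> P n) \<cdot> p)" using t P[of n] by simp
    also have "?v \<cdot> P n = P (Suc n)" by (simp add: P_def)
    finally show ?case .
  qed
  obtain n where "P n = hzero T Z Z" using nil by (auto simp: nilpotent_endo_def P_def)
  then have "((\<lambda>w. (a \<cdot> p) \<cdot> w) ^^ Suc n) (ident T W) = hzero T W W"
    unfolding eq using t Z by simp
  then show ?thesis unfolding nilpotent_endo_def using t by (auto simp: hom_iff simp del: funpow.simps)
qed

text \<open>Given \<open>Z \<rightarrow> Z \<oplus> M \<rightarrow> N\<close> with first morphism \<open>\<phi>\<close>, and a further step \<open>M \<rightarrow> M' \<rightarrow> A\<close> of the
  filtration, the sum of the two triangles is \<open>W \<rightarrow> W \<oplus> M' \<rightarrow> N \<oplus> A\<close> with \<open>W = Z \<oplus> M\<close>. The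
  new endomorphism \<open>\<phi> p\<close> of \<open>W\<close> is nilpotent since \<open>p \<phi> = v\<close> is.\<close>

lemma filtered_degeneration:
  assumes "M \<in> filtered T V"
  shows "\<exists>N \<in> finite_dsums T V. le_Delta_nil T M N"
proof -
  have "\<exists>Z v N. N \<in> finite_dsums T V \<and> degen_triangle T Z v M N \<and> nilpotent_endo T Z v"
    using assms
  proof (induction rule: filtered.induct)
    case (zero M)
    have M: "M \<in> obj T" using zero by (rule zero_obj_obj)
    let ?z = "hzero T M M"
    have "dist_tri T M M M ((ident T M \<cdot> ?z) \<boxplus> (?z \<cdot> ?z)) (ident T M) (hzero T M (sobj T M))"
      using dist_tri_ident_left[OF M zero] M by simp
    moreover have "?z \<in> hom_set T M M" using M by (simp add: hom_iff)
    ultimately have "degen_triangle T M ?z M M"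
      unfolding degen_triangle_def using M biproduct_zero_right[OF M zero] by blast
    moreover have "nilpotent_endo T M ?z"
      unfolding nilpotent_endo_def using M zero
      by (auto simp: hom_iff zero_obj_iff intro!: exI[of _ 0])
    moreover have "M \<in> finite_dsums T V" using zero by (rule finite_dsums.zero)
    ultimately show ?case by blast
  next
    case (extend M A M' f g h)
    then obtain Z v N where N: "N \<in> finite_dsums T V" and d: "degen_triangle T Z v M N"
      and nil: "nilpotent_endo T Z v" by blast
    note f = dist_tri_simps[OF extend.hyps(3)]
    obtain W i j p q u g1 h1 where v: "v \<in> hom_set T Z Z" and u: "u \<in> hom_set T Z M"
      and b: "is_biproduct T Z M W i j p q"
      and dd: "dist_tri T Z W N ((i \<cdot> v) \<boxplus> (j \<cdot> u)) g1 h1"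
      using d unfolding degen_triangle_def by blast
    \<comment> \<open>the object \<open>W\<close>, a sum of \<open>Z\<close> and \<open>M\<close>, is the new auxiliary object\<close>
    define \<phi> where "\<phi> = (i \<cdot> v) \<boxplus> (j \<cdot> u)"
    note t = biproduct_simps[OF b] v[unfolded hom_iff] u[unfolded hom_iff]
    note dd = dd[folded \<phi>_def]
    note \<phi> = dist_tri_simps[OF dd]
    obtain W' where "is_dsum T W M' W'" using dsum_exists[of W M'] t f by blast
    then obtain i' j' p' q' where b': "is_biproduct T W M' W' i' j' p' q'" by (rule is_dsumE)
    obtain N' where N': "is_dsum T N A N'" using dsum_exists[of N A] \<phi> f by blast
    then obtain i2 j2 p2 q2 where b2: "is_biproduct T N A N' i2 j2 p2 q2" by (rule is_dsumE)
    obtain g2 h2 where "dist_tri T W W' N' (i' \<cdot> (\<phi> \<cdot> p) \<boxplus> j' \<cdot> (f \<cdot> q)) g2 h2"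
      using dist_tri_sum[OF b b' b2 dd extend.hyps(3)] by blast
    moreover have "\<phi> \<cdot> p \<in> hom_set T W W" "f \<cdot> q \<in> hom_set T W M'"
      using t f \<phi> by (auto simp: hom_iff)
    ultimately have "degen_triangle T W (\<phi> \<cdot> p) M' N'"
      unfolding degen_triangle_def using b' t f is_dsum_obj[OF N'] by blast
    moreover have "nilpotent_endo T W (\<phi> \<cdot> p)"
    proof (rule nilpotent_endo_cycle)
      show "\<phi> \<in> hom_set T Z W" "p \<in> hom_set T W Z" using \<phi> t by (auto simp: hom_iff)
      have "p \<cdot> \<phi> = v" using t by (simp add: \<phi>_def)
      then show "nilpotent_endo T Z (p \<cdot> \<phi>)" using nil by simp
    qed
    moreover have "N' \<in> finite_dsums T V"
      using extend.hyps(2) N is_dsum_commute[OF N'] by (rule finite_dsums.step)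
    ultimately show ?case by blast
  qed
  then show ?thesis unfolding le_Delta_nil_def by blast
qed

section \<open>Triangulated subcategories\<close>

lemma triangulated_subcategoryD:
  assumes "triangulated_subcategory T D"
  shows "X \<in> D \<Longrightarrow> X \<in> obj T"
    and "is_zero_obj T Z \<Longrightarrow> Z \<in> D"
    and "X \<in> D \<Longrightarrow> isomorphic T X Y \<Longrightarrow> Y \<in> D"
    and "X \<in> D \<Longrightarrow> sobj T X \<in> D"
    and "X \<in> D \<Longrightarrow> unshift T X \<in> D"
    and "triangle X Y Z \<Longrightarrow> X \<in> D \<Longrightarrow> Y \<in> D \<Longrightarrow> Z \<in> D"
  using assms unfolding triangulated_subcategory_def triangle_def shift_1 shift_minus_1 by blast+

lemma triangulated_subcategory_unshift:
  assumes D: "triangulated_subcategory T D" and X: "sobj T X \<in> D" "X \<in> obj T" shows "X \<in> D"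
proof -
  note u = unshift_obj_iso[OF triangulated_subcategoryD(1)[OF D X(1)]]
  have "isomorphic T (unshift T (sobj T X)) X"
    using u(2,1) X(2) by (rule isomorphic_shift_cancel)
  then show ?thesis using triangulated_subcategoryD(3,5)[OF D] X(1) by blast
qed

lemma triangulated_subcategory_fibre:
  assumes D: "triangulated_subcategory T D" and "triangle X Y Z" "Y \<in> D" "Z \<in> D" shows "X \<in> D"
  using triangulated_subcategory_unshift[OF D] triangulated_subcategoryD(6)[OF D triangle_rotate]
    assms(2-4) triangle_obj(1) by blast

lemma triangulated_subcategory_extension:
  assumes D: "triangulated_subcategory T D" and "triangle X Y Z" "X \<in> D" "Z \<in> D" shows "Y \<in> D"
  using triangulated_subcategory_fibre[OF D triangle_rotate[OF assms(2)] assms(4)]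
    triangulated_subcategoryD(4)[OF D assms(3)] by blast

lemma triangulated_subcategory_dsum:
  assumes D: "triangulated_subcategory T D" and "is_dsum T X Y W" "X \<in> D"
  shows "W \<in> D \<longleftrightarrow> Y \<in> D"
  using triangle_split[OF assms(2)] triangulated_subcategoryD(6)[OF D] assms(3)
    triangulated_subcategory_extension[OF D] by blast

text \<open>Closure under negative shifts is stated without the chosen object \<^const>\<open>unshift\<close>, in a form
  that passes to intersections and to the examples below.\<close>

lemma triangulated_subcategoryI:
  assumes "D \<subseteq> obj T"
    and "\<And>Z. is_zero_obj T Z \<Longrightarrow> Z \<in> D"
    and "\<And>X Y. X \<in> D \<Longrightarrow> isomorphic T X Y \<Longrightarrow> Y \<in> D"
    and "\<And>X. X \<in> D \<Longrightarrow> sobj T X \<in> D"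
    and "\<And>X. X \<in> obj T \<Longrightarrow> sobj T X \<in> D \<Longrightarrow> X \<in> D"
    and "\<And>X Y Z. triangle X Y Z \<Longrightarrow> X \<in> D \<Longrightarrow> Y \<in> D \<Longrightarrow> Z \<in> D"
  shows "triangulated_subcategory T D"
proof -
  have "unshift T X \<in> D" if "X \<in> D" for X
  proof -
    note u = unshift_obj_iso[of X]
    have "X \<in> obj T" using that assms(1) by blast
    then show ?thesis using assms(3)[OF that isomorphic_sym[OF u(2)]] assms(5) u(1) by blast
  qed
  then show ?thesis
    unfolding triangulated_subcategory_def shift_1 shift_minus_1
    using assms(1-4) assms(6)[OF triangleI] by blast
qed

lemma triangulated_subcategory_obj: "triangulated_subcategory T (obj T)"
  by (rule triangulated_subcategoryI) (auto simp: zero_obj_obj isomorphic_obj triangle_obj)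

lemma triangulated_subcategory_tria:
  assumes "U \<subseteq> obj T" shows "triangulated_subcategory T (tria T U)"
proof -
  let ?F = "{D. triangulated_subcategory T D \<and> U \<subseteq> D}"
  have F: "obj T \<in> ?F" using triangulated_subcategory_obj assms by blast
  note D = triangulated_subcategoryD
  show ?thesis
    unfolding tria_def
  proof (rule triangulated_subcategoryI)
    show "\<Inter> ?F \<subseteq> obj T" using F by blast
    show "Z \<in> \<Inter> ?F" if "is_zero_obj T Z" for Z using that D(2) by blast
    show "Y \<in> \<Inter> ?F" if "X \<in> \<Inter> ?F" "isomorphic T X Y" for X Y using that D(3) by blast
    show "sobj T X \<in> \<Inter> ?F" if "X \<in> \<Inter> ?F" for X using that D(4) by blast
    show "X \<in> \<Inter> ?F" if "X \<in> obj T" "sobj T X \<in> \<Inter> ?F" for X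
      using that triangulated_subcategory_unshift by blast
    show "Z \<in> \<Inter> ?F" if "triangle X Y Z" "X \<in> \<Inter> ?F" "Y \<in> \<Inter> ?F" for X Y Z
      using that D(6) by blast
  qed
qed

lemma tria_least: "triangulated_subcategory T D \<Longrightarrow> U \<subseteq> D \<Longrightarrow> tria T U \<subseteq> D"
  by (auto simp: tria_def)

section \<open>Dense triangulated subcategories\<close>

text \<open>If \<open>X \<oplus> X'\<close> and \<open>Y \<oplus> Y'\<close> are in \<open>D\<close>, so is the cone of \<open>f \<oplus> 0\<close>, and the cone of \<open>f\<close> is one of
  its direct summands.\<close>

lemma summands_triangulated:
  assumes D: "triangulated_subcategory T D"
  shows "triangulated_subcategory T {X. \<exists>X'. \<exists>W \<in> D. is_dsum T X X' W}"
    (is "triangulated_subcategory T ?E")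
proof (rule triangulated_subcategoryI)
  note C = triangulated_subcategoryD[OF D]
  show "?E \<subseteq> obj T" using is_dsum_obj by blast
  show "Z \<in> ?E" if Z: "is_zero_obj T Z" for Z
    using is_dsum_zero_right[OF zero_obj_obj[OF Z] Z] C(2)[OF Z] by blast
  show "Y \<in> ?E" if "X \<in> ?E" "isomorphic T X Y" for X Y
  proof -
    obtain X' W where W: "W \<in> D" "is_dsum T X X' W" using \<open>X \<in> ?E\<close> by blast
    have "is_dsum T Y X' W"
      using is_dsum_obj[OF W(2)] by (intro is_dsum_iso[OF W(2) \<open>isomorphic T X Y\<close>]) auto
    then show ?thesis using W by blast
  qed
  show "sobj T X \<in> ?E" if "X \<in> ?E" for X
    using that is_dsum_shift C(4) by blast
  show "X \<in> ?E" if X: "X \<in> obj T" "sobj T X \<in> ?E" for X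
  proof -
    obtain X' W where W: "W \<in> D" "is_dsum T (sobj T X) X' W" using X(2) by blast
    note o = is_dsum_obj[OF W(2)]
    note u = unshift_obj_iso[OF o(2)] unshift_obj_iso[OF o(3)]
    have "is_dsum T (sobj T X) (sobj T (unshift T X')) (sobj T (unshift T W))"
      using is_dsum_iso[OF W(2) isomorphic_refl[OF o(1)] isomorphic_sym isomorphic_sym] u by blast
    then have "is_dsum T X (unshift T X') (unshift T W)"
      by (rule is_dsum_shift_cancel) (use X u in auto)
    then show ?thesis using C(5)[OF W(1)] by blast
  qed
  show "Z \<in> ?E" if t: "triangle X Y Z" and X: "X \<in> ?E" and Y: "Y \<in> ?E" for X Y Z
  proof -
    obtain X' P where P: "P \<in> D" "is_dsum T X X' P" using X by blast
    obtain Y' Q where Q: "Q \<in> D" "is_dsum T Y Y' Q" using Y by blast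
    have "hzero T X' Y' \<in> hom_set T X' Y'"
      using is_dsum_obj[OF P(2)] is_dsum_obj[OF Q(2)] by (simp add: hom_iff)
    then obtain Z' where Z': "triangle X' Y' Z'" using tri_cone unfolding triangle_def by blast
    obtain R where R: "is_dsum T Z Z' R"
      using dsum_exists[OF triangle_obj(3)[OF t] triangle_obj(3)[OF Z']] by blast
    have "triangle P Q R" by (rule triangle_sum[OF P(2) Q(2) R t Z'])
    then show ?thesis using C(6) P(1) Q(1) R by blast
  qed
qed

subsection \<open>The group of objects modulo a dense subcategory\<close>

text \<open>The set of complements of \<open>X\<close> is a complete invariant of the class of \<open>X\<close> modulo \<open>D\<close>; using it
  as the class itself avoids forming a quotient by an equivalence relation.\<close>

definition complements :: "'o set \<Rightarrow> 'o \<Rightarrow> 'o set" where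
  "complements D X = {Z. \<exists>W \<in> D. is_dsum T X Z W}"

text \<open>The operation is induced by direct sums. It does not depend on the choices by
  \<open>complements_dsum_cong\<close>.\<close>

definition complement_group :: "'o set \<Rightarrow> 'o set monoid" where
  "complement_group D = \<lparr>carrier = complements D ` obj T,
     monoid.mult = (\<lambda>a b. SOME c. \<exists>X Y V. a = complements D X \<and> b = complements D Y \<and>
        is_dsum T X Y V \<and> c = complements D V),
     one = D\<rparr>"

lemma complements_iso:
  assumes "isomorphic T X Y" shows "complements D X = complements D Y"
proof -
  have "complements D X \<subseteq> complements D Y" if "isomorphic T X Y" for X Y
    using is_dsum_iso[OF _ that isomorphic_refl isomorphic_refl] is_dsum_obj
    unfolding complements_def by blast
  then show ?thesis using assms isomorphic_sym[OF assms] by blast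
qed

text \<open>By associativity, a complement of \<open>X \<oplus> Y\<close> is an object \<open>Z\<close> such that \<open>Y \<oplus> Z\<close> is a complement of
  \<open>X\<close>. Hence the complements of \<open>X \<oplus> Y\<close> depend on \<open>X\<close> only through its own complements.\<close>

lemma complements_dsum:
  assumes D: "triangulated_subcategory T D" and V: "is_dsum T X Y V"
  shows "complements D V = {Z. \<exists>U \<in> complements D X. is_dsum T Y Z U}"
proof (intro Set.set_eqI iffI)
  fix Z assume "Z \<in> complements D V"
  then obtain W where W: "W \<in> D" "is_dsum T V Z W" by (auto simp: complements_def)
  obtain U where U: "is_dsum T Y Z U"
    using dsum_exists is_dsum_obj[OF V] is_dsum_obj[OF W(2)] by blast
  have "is_dsum T X U W" by (rule is_dsum_assoc[OF V W(2) U])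
  then show "Z \<in> {Z. \<exists>U \<in> complements D X. is_dsum T Y Z U}"
    using U W by (auto simp: complements_def)
next
  fix Z assume "Z \<in> {Z. \<exists>U \<in> complements D X. is_dsum T Y Z U}"
  then obtain U W where U: "is_dsum T Y Z U" "is_dsum T X U W" "W \<in> D"
    by (auto simp: complements_def)
  obtain W' where W': "is_dsum T V Z W'"
    using dsum_exists is_dsum_obj[OF V] is_dsum_obj[OF U(1)] by blast
  have "is_dsum T X U W'" by (rule is_dsum_assoc[OF V W' U(1)])
  then have "W' \<in> D"
    using triangulated_subcategoryD(3)[OF D U(3) is_dsum_unique[OF U(2)]] by blast
  then show "Z \<in> complements D V" using W' by (auto simp: complements_def)
qed

text \<open>The two summands are replaced one after the other, by symmetry of the direct sum.\<close>

lemma complements_dsum_cong: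
  assumes D: "triangulated_subcategory T D" and "is_dsum T X Y V" "is_dsum T X' Y' V'"
    and "complements D X = complements D X'" "complements D Y = complements D Y'"
  shows "complements D V = complements D V'"
proof -
  obtain V'' where V'': "is_dsum T X' Y V''"
    using dsum_exists is_dsum_obj[OF assms(2)] is_dsum_obj[OF assms(3)] by blast
  have "complements D V = complements D V''"
    using complements_dsum[OF D assms(2)] complements_dsum[OF D V''] assms(4) by simp
  also have "\<dots> = complements D V'"
    using complements_dsum[OF D is_dsum_commute[OF V'']]
      complements_dsum[OF D is_dsum_commute[OF assms(3)]] assms(5) by simp
  finally show ?thesis .
qed

lemma complement_group_mult:
  assumes D: "triangulated_subcategory T D" and V: "is_dsum T X Y V"
  shows "complements D X \<otimes>\<^bsub>complement_group D\<^esub> complements D Y = complements D V"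
proof -
  let ?P = "\<lambda>c. \<exists>X' Y' V'. complements D X = complements D X' \<and> complements D Y = complements D Y' \<and>
    is_dsum T X' Y' V' \<and> c = complements D V'"
  have "?P (complements D V)" using V by blast
  then have "?P (SOME c. ?P c)" by (rule someI)
  then have "(SOME c. ?P c) = complements D V" using complements_dsum_cong[OF D V] by metis
  then show ?thesis by (simp add: complement_group_def)
qed

lemma complements_eq_iff:
  assumes D: "triangulated_subcategory T D" and X: "X \<in> obj T"
  shows "complements D X = D \<longleftrightarrow> X \<in> D"
proof
  assume *: "complements D X = D"
  obtain Z where Z: "is_zero_obj T Z" using zero_obj_exists by blast
  then have "Z \<in> complements D X" using * triangulated_subcategoryD(2)[OF D] by blast
  then obtain W where W: "W \<in> D" "is_dsum T X Z W" by (auto simp: complements_def)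
  show "X \<in> D"
    using triangulated_subcategoryD(3)[OF D W(1)] is_dsum_unique[OF W(2)]
      is_dsum_zero_right[OF X Z] by blast
next
  assume "X \<in> D"
  note d = triangulated_subcategory_dsum[OF D _ \<open>X \<in> D\<close>]
  have "Z \<in> complements D X" if "Z \<in> D" for Z
    using d that dsum_exists[OF X triangulated_subcategoryD(1)[OF D that]]
    unfolding complements_def by blast
  then show "complements D X = D" using d unfolding complements_def by blast
qed

text \<open>Density provides the inverses: if \<open>X \<oplus> X'\<close> is in \<open>D\<close>, the class of \<open>X'\<close> is inverse to that of
  \<open>X\<close>.\<close>

lemma complement_group_comm_group:
  assumes D: "triangulated_subcategory T D"
    and dense: "\<And>X. X \<in> obj T \<Longrightarrow> \<exists>X'. \<exists>W \<in> D. is_dsum T X X' W"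
  shows "comm_group (complement_group D)"
proof -
  let ?G = "complement_group D" and ?C = "complements D"
  have car: "carrier ?G = ?C ` obj T" and one: "\<one>\<^bsub>?G\<^esub> = D"
    by (simp_all add: complement_group_def)
  note m = complement_group_mult[OF D]
  obtain O' where O': "is_zero_obj T O'" using zero_obj_exists by blast
  have O'D: "?C O' = D" "O' \<in> obj T"
    using complements_eq_iff[OF D] triangulated_subcategoryD(2)[OF D O'] zero_obj_obj[OF O'] by auto
  show ?thesis
  proof (rule comm_groupI; unfold car one)
    fix x y assume "x \<in> ?C ` obj T" "y \<in> ?C ` obj T"
    then obtain X Y where X: "x = ?C X" "X \<in> obj T" "y = ?C Y" "Y \<in> obj T" by blast
    then obtain V where V: "is_dsum T X Y V" using dsum_exists by blast
    show "x \<otimes>\<^bsub>?G\<^esub> y \<in> ?C ` obj T" using X m[OF V] is_dsum_obj[OF V] by blast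
    show "x \<otimes>\<^bsub>?G\<^esub> y = y \<otimes>\<^bsub>?G\<^esub> x" using X m[OF V] m[OF is_dsum_commute[OF V]] by simp
  next
    show "D \<in> ?C ` obj T" using O'D by blast
  next
    fix x y z assume "x \<in> ?C ` obj T" "y \<in> ?C ` obj T" "z \<in> ?C ` obj T"
    then obtain X Y Z where X: "x = ?C X" "X \<in> obj T" "y = ?C Y" "Y \<in> obj T" "z = ?C Z" "Z \<in> obj T"
      by blast
    obtain V where V: "is_dsum T X Y V" using dsum_exists X by blast
    obtain U where U: "is_dsum T Y Z U" using dsum_exists X by blast
    obtain W where W: "is_dsum T V Z W" using dsum_exists X is_dsum_obj[OF V] by blast
    have "is_dsum T X U W" by (rule is_dsum_assoc[OF V W U])
    then show "x \<otimes>\<^bsub>?G\<^esub> y \<otimes>\<^bsub>?G\<^esub> z = x \<otimes>\<^bsub>?G\<^esub> (y \<otimes>\<^bsub>?G\<^esub> z)"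
      using X m[OF V] m[OF U] m[OF W] m[of X U W] by simp
  next
    fix x assume "x \<in> ?C ` obj T"
    then obtain X where X: "x = ?C X" "X \<in> obj T" by blast
    show "D \<otimes>\<^bsub>?G\<^esub> x = x"
      using m[OF is_dsum_commute[OF is_dsum_zero_right[OF X(2) O']]] X(1) O'D by simp
    obtain X' W where W: "W \<in> D" "is_dsum T X X' W" using dense[OF X(2)] by blast
    have "?C X' \<otimes>\<^bsub>?G\<^esub> x = D"
      using m[OF is_dsum_commute[OF W(2)]] complements_eq_iff[OF D] W is_dsum_obj[OF W(2)] X by simp
    then show "\<exists>y \<in> ?C ` obj T. y \<otimes>\<^bsub>?G\<^esub> x = D" using is_dsum_obj[OF W(2)] by blast
  qed
qed

text \<open>Choose complements \<open>X'\<close> of \<open>X\<close> and \<open>Z'\<close> of \<open>Z\<close>. Adding the split triangle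
  \<open>X' \<rightarrow> X' \<oplus> Z' \<rightarrow> Z'\<close> shows that \<open>X' \<oplus> Z'\<close> is a complement of \<open>Y\<close>, and it is one of \<open>X \<oplus> Z\<close>.\<close>

lemma complement_group_triangle:
  assumes D: "triangulated_subcategory T D"
    and dense: "\<And>X. X \<in> obj T \<Longrightarrow> \<exists>X'. \<exists>W \<in> D. is_dsum T X X' W"
    and t: "triangle X Y Z"
  shows "complements D X \<otimes>\<^bsub>complement_group D\<^esub> complements D Z = complements D Y"
proof -
  let ?G = "complement_group D" and ?C = "complements D"
  interpret G: comm_group ?G by (rule complement_group_comm_group[OF D dense])
  have car: "?C X \<in> carrier ?G" if "X \<in> obj T" for X
    using that by (simp add: complement_group_def)
  have one: "\<one>\<^bsub>?G\<^esub> = D" by (simp add: complement_group_def)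
  note m = complement_group_mult[OF D]
  note o = triangle_obj[OF t]
  obtain X' P where P: "P \<in> D" "is_dsum T X X' P" using dense[OF o(1)] by blast
  obtain Z' Q where Q: "Q \<in> D" "is_dsum T Z Z' Q" using dense[OF o(3)] by blast
  note o = o is_dsum_obj[OF P(2)] is_dsum_obj[OF Q(2)]
  obtain V where V: "is_dsum T X' Z' V" using dsum_exists o by blast
  obtain R where R: "is_dsum T Y V R" using dsum_exists o is_dsum_obj[OF V] by blast
  have "triangle P R Q" by (rule triangle_sum[OF P(2) R Q(2) t triangle_split[OF V]])
  then have "R \<in> D" using P(1) Q(1) by (rule triangulated_subcategory_extension[OF D])
  have e: "?C W = \<one>\<^bsub>?G\<^esub>" if "W \<in> D" for W
    using complements_eq_iff[OF D] triangulated_subcategoryD(1)[OF D that] that one by blast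
  have "?C Y \<otimes>\<^bsub>?G\<^esub> (?C X' \<otimes>\<^bsub>?G\<^esub> ?C Z') = \<one>\<^bsub>?G\<^esub>"
    using m[OF R] m[OF V] e[OF \<open>R \<in> D\<close>] by simp
  moreover have "(?C X \<otimes>\<^bsub>?G\<^esub> ?C Z) \<otimes>\<^bsub>?G\<^esub> (?C X' \<otimes>\<^bsub>?G\<^esub> ?C Z')
      = (?C X \<otimes>\<^bsub>?G\<^esub> ?C X') \<otimes>\<^bsub>?G\<^esub> (?C Z \<otimes>\<^bsub>?G\<^esub> ?C Z')"
    using car o by (simp add: G.m_ac)
  moreover have "\<dots> = \<one>\<^bsub>?G\<^esub>" using m[OF P(2)] m[OF Q(2)] e[OF P(1)] e[OF Q(1)] by simp
  ultimately show ?thesis using G.right_cancel[of "?C X' \<otimes>\<^bsub>?G\<^esub> ?C Z'" "?C X \<otimes>\<^bsub>?G\<^esub> ?C Z" "?C Y"] car o by simp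
qed

section \<open>The Grothendieck group\<close>

subsection \<open>Relations\<close>

abbreviation cl :: "'o \<Rightarrow> ('o set \<Rightarrow>\<^sub>0 int)" where "cl X \<equiv> frag_of (iso_class T X)"

lemma K0_relations_subgroup: "subgroup (K0_relations T) (K0_free T)"
proof -
  interpret F: group "K0_free T" by (simp add: K0_free_def)
  have c: "cl X \<in> carrier (K0_free T)" if "X \<in> obj T" for X
    using that by (simp add: K0_free_def)
  have "cl X - cl Y + cl Z \<in> carrier (K0_free T)" if "X \<in> obj T" "Y \<in> obj T" "Z \<in> obj T" for X Y Z
    using F.m_closed[OF F.m_closed[OF c[OF that(1)] F.inv_closed[OF c[OF that(2)]]] c[OF that(3)]]
      that by (simp add: K0_free_def)
  then show ?thesis unfolding K0_relations_def
    by (intro F.generate_is_subgroup) (auto dest: dist_tri_simps(10-12))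
qed

lemma K0_relations_0: "0 \<in> K0_relations T"
  using subgroup.one_closed[OF K0_relations_subgroup] by (simp add: K0_free_def)

lemma K0_relations_add:
  "a \<in> K0_relations T \<Longrightarrow> b \<in> K0_relations T \<Longrightarrow> a + b \<in> K0_relations T"
  using subgroup.m_closed[OF K0_relations_subgroup] by (simp add: K0_free_def)

lemma K0_relations_uminus:
  assumes "a \<in> K0_relations T" shows "- a \<in> K0_relations T"
proof -
  have "a \<in> carrier (K0_free T)" using assms K0_relations_subgroup by (rule subgroup.mem_carrier[rotated])
  then show ?thesis
    using subgroup.m_inv_closed[OF K0_relations_subgroup assms] by (simp add: K0_free_def)
qed

lemma K0_relations_diff:
  "a \<in> K0_relations T \<Longrightarrow> b \<in> K0_relations T \<Longrightarrow> a - b \<in> K0_relations T"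
  using K0_relations_add[of a "- b"] K0_relations_uminus by simp

lemma K0_relations_triangle: "triangle X Y Z \<Longrightarrow> cl X - cl Y + cl Z \<in> K0_relations T"
  unfolding K0_relations_def triangle_def by (rule generate.incl) blast

text \<open>This reduces all computations in \<open>K\<^sub>0\<close> to the subgroup of relations of the free group.\<close>

lemma T0_iff: "X \<in> T0 T \<longleftrightarrow> X \<in> obj T \<and> cl X \<in> K0_relations T"
proof -
  interpret F: group "K0_free T" by (simp add: K0_free_def)
  have "K0_class T X = \<one>\<^bsub>K0 T\<^esub> \<longleftrightarrow> cl X \<in> K0_relations T" if X: "X \<in> obj T"
  proof -
    have c: "cl X \<in> carrier (K0_free T)" using X by (simp add: K0_free_def)
    have "K0_class T X = \<one>\<^bsub>K0 T\<^esub> \<longleftrightarrow> K0_relations T #>\<^bsub>K0_free T\<^esub> cl X = K0_relations T"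
      by (simp add: K0_class_def K0_def FactGroup_def)
    also have "\<dots> \<longleftrightarrow> cl X \<in> K0_relations T"
      using F.coset_join1[OF _ c K0_relations_subgroup] F.coset_join2[OF c K0_relations_subgroup]
      by blast
    finally show ?thesis .
  qed
  then show ?thesis unfolding T0_def by blast
qed

lemma cl_zero: "is_zero_obj T Z \<Longrightarrow> cl Z \<in> K0_relations T"
  using K0_relations_triangle[OF triangle_zero_left[of Z Z]] zero_obj_obj by simp

lemma cl_shift: "X \<in> obj T \<Longrightarrow> cl X + cl (sobj T X) \<in> K0_relations T"
proof -
  assume X: "X \<in> obj T"
  obtain Z where Z: "is_zero_obj T Z" using zero_obj_exists by blast
  show ?thesis
    using K0_relations_add[OF K0_relations_triangle[OF triangle_zero_mid[OF X Z]] cl_zero[OF Z]] by simp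
qed

lemma cl_shift_int:
  assumes X: "X \<in> obj T"
  shows "cl (shift T r X) - (if even r then cl X else - cl X) \<in> K0_relations T"
proof -
  have s: "cl (shift T r X) + cl (shift T (r + 1) X) \<in> K0_relations T" for r
    using cl_shift[OF shift_obj[OF X], of r] iso_class_eq[OF shift_succ[OF X, of r]] by simp
  show ?thesis
  proof (induction r rule: int_induct[where k = 0])
    case base
    then show ?case using K0_relations_0 by simp
  next
    case (step1 r)
    then show ?case using K0_relations_diff[OF s[of r] step1(2)]
      by (cases "even r") (simp_all add: algebra_simps)
  next
    case (step2 r)
    then show ?case using K0_relations_diff[OF s[of "r - 1"] step2(2)]
      by (cases "even r") (simp_all add: algebra_simps)
  qed
qed

lemma triangulated_subcategory_T0: "triangulated_subcategory T (T0 T)"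
proof (rule triangulated_subcategoryI)
  show "T0 T \<subseteq> obj T" by (auto simp: T0_def)
  show "Z \<in> T0 T" if "is_zero_obj T Z" for Z
    using that cl_zero zero_obj_obj by (simp add: T0_iff)
  show "Y \<in> T0 T" if "X \<in> T0 T" "isomorphic T X Y" for X Y
    using that iso_class_eq isomorphic_obj by (simp add: T0_iff)
  show "sobj T X \<in> T0 T" if "X \<in> T0 T" for X
    using that K0_relations_diff[OF cl_shift[of X], of "cl X"] by (simp add: T0_iff)
  show "X \<in> T0 T" if "X \<in> obj T" "sobj T X \<in> T0 T" for X
    using that K0_relations_diff[OF cl_shift[of X], of "cl (sobj T X)"] by (simp add: T0_iff)
  show "Z \<in> T0 T" if t: "triangle X Y Z" "X \<in> T0 T" "Y \<in> T0 T" for X Y Z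
  proof -
    have "(cl X - cl Y + cl Z) - cl X + cl Y \<in> K0_relations T"
      by (rule K0_relations_add[OF K0_relations_diff[OF K0_relations_triangle[OF t(1)]]])
        (use t in \<open>auto simp: T0_iff\<close>)
    then show ?thesis using triangle_obj[OF t(1)] by (simp add: T0_iff)
  qed
qed

lemma dsum_odd_shift_T0:
  assumes "is_dsum T A (shift T r A) X" "odd r" shows "X \<in> T0 T"
proof -
  note o = is_dsum_obj[OF assms(1)]
  have "(cl (shift T r A) - (- cl A)) - (cl A - cl X + cl (shift T r A)) \<in> K0_relations T"
    by (rule K0_relations_diff[OF _ K0_relations_triangle[OF triangle_split[OF assms(1)]]])
      (use cl_shift_int[OF o(1), of r] assms(2) in simp)
  then show ?thesis using o by (simp add: T0_iff)
qed

text \<open>In \<open>K\<^sub>0\<close>, the triangle \<open>Z \<rightarrow> Z \<oplus> M \<rightarrow> N\<close> and the split one \<open>Z \<rightarrow> Z \<oplus> M \<rightarrow> M\<close> give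
  \<open>[N] = [M]\<close>.\<close>

lemma le_Delta_T0:
  assumes "le_Delta T M N" shows "M \<in> T0 T \<longleftrightarrow> N \<in> T0 T"
proof -
  obtain Z W where Z: "is_dsum T Z M W" "triangle Z W N"
    using assms unfolding le_Delta_def degen_triangle_def triangle_def by (blast intro: is_dsumI)
  have d: "(cl Z - cl W + cl N) - (cl Z - cl W + cl M) \<in> K0_relations T"
    by (intro K0_relations_diff K0_relations_triangle Z triangle_split)
  then have "cl N - cl M \<in> K0_relations T" by simp
  then have "cl M \<in> K0_relations T \<longleftrightarrow> cl N \<in> K0_relations T"
    using K0_relations_add[of "cl N - cl M" "cl M"] K0_relations_diff[of "cl N" "cl N - cl M"] by auto
  then show ?thesis using triangle_obj[OF Z(2)] is_dsum_obj[OF Z(1)] by (auto simp: T0_iff)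
qed

lemma le_Delta_nil_imp: "le_Delta_nil T M N \<Longrightarrow> le_Delta T M N"
  by (auto simp: le_Delta_nil_def le_Delta_def)

lemma prec_Delta_nil_T0:
  assumes "prec_Delta_nil T M N" shows "M \<in> T0 T \<longleftrightarrow> N \<in> T0 T"
  using assms unfolding prec_Delta_nil_def
  by (induction rule: tranclp_induct) (use le_Delta_T0[OF le_Delta_nil_imp] in blast)+

text \<open>Taking complements is additive on triangles, so it induces a homomorphism that vanishes on all
  relations. An object of class zero then has the same complements as a zero object, that is \<open>D\<close>.\<close>

lemma T0_subset_dense:
  assumes D: "triangulated_subcategory T D"
    and dense: "\<And>X. X \<in> obj T \<Longrightarrow> \<exists>X'. \<exists>W \<in> D. is_dsum T X X' W"
  shows "T0 T \<subseteq> D"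
proof
  let ?G = "complement_group D" and ?C = "complements D"
  let ?S = "iso_class T ` obj T"
  interpret G: comm_group ?G by (rule complement_group_comm_group[OF D dense])
  have car: "?C X \<in> carrier ?G" if "X \<in> obj T" for X
    using that by (simp add: complement_group_def)
  \<comment> \<open>generators are isomorphism classes, and isomorphic objects have the same complements\<close>
  define f where "f c = ?C (SOME X. X \<in> c)" for c
  have f: "f (iso_class T X) = ?C X" if "X \<in> obj T" for X
  proof -
    have "X \<in> iso_class T X" using that by (simp add: iso_class_def)
    then have "(SOME X'. X' \<in> iso_class T X) \<in> iso_class T X" by (rule someI)
    then show ?thesis unfolding f_def iso_class_def by (intro complements_iso[symmetric]) simp
  qed
  have "f ` ?S \<subseteq> carrier ?G" using f car by auto
  from G.free_Abelian_group_universal[OF this]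
  obtain h where h: "h \<in> hom (free_Abelian_group ?S) ?G" "\<And>x. x \<in> ?S \<Longrightarrow> h (frag_of x) = f x"
    by blast
  interpret h: group_hom "K0_free T" ?G h
    using h(1) by (simp add: group_hom_def group_hom_axioms_def K0_free_def)
  have hC: "h (cl X) = ?C X" if "X \<in> obj T" for X using h(2) f that by auto
  have "cl X - cl Y + cl Z \<in> kernel (K0_free T) ?G h" if t: "triangle X Y Z" for X Y Z
  proof -
    note o = triangle_obj[OF t]
    have c: "cl X \<in> carrier (K0_free T)" if "X \<in> obj T" for X
      using that by (simp add: K0_free_def)
    note cc = c[OF o(1)] c[OF o(2)] c[OF o(3)]
    have e: "cl X - cl Y + cl Z = cl X \<otimes>\<^bsub>K0_free T\<^esub> inv\<^bsub>K0_free T\<^esub> cl Y \<otimes>\<^bsub>K0_free T\<^esub> cl Z"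
      using o by (simp add: K0_free_def)
    have "h (cl X - cl Y + cl Z) = ?C X \<otimes>\<^bsub>?G\<^esub> inv\<^bsub>?G\<^esub> ?C Y \<otimes>\<^bsub>?G\<^esub> ?C Z"
      unfolding e using cc o by (simp add: hC)
    also have "\<dots> = (?C X \<otimes>\<^bsub>?G\<^esub> ?C Z) \<otimes>\<^bsub>?G\<^esub> inv\<^bsub>?G\<^esub> ?C Y"
      using car o by (simp add: G.m_ac)
    also have "\<dots> = \<one>\<^bsub>?G\<^esub>" using complement_group_triangle[OF D dense t] car o by simp
    finally show ?thesis using cc unfolding kernel_def e by simp
  qed
  then have "K0_relations T \<subseteq> kernel (K0_free T) ?G h"
    unfolding K0_relations_def by (intro h.G.generate_subgroup_incl h.subgroup_kernel) (auto intro: triangleI)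
  fix X assume "X \<in> T0 T"
  then have X: "X \<in> obj T" "cl X \<in> K0_relations T" by (auto simp: T0_iff)
  then have "h (cl X) = \<one>\<^bsub>?G\<^esub>" using \<open>K0_relations T \<subseteq> _\<close> by (auto simp: kernel_def)
  then have "?C X = D" using hC[OF X(1)] by (simp add: complement_group_def)
  then show "X \<in> D" using complements_eq_iff[OF D X(1)] by blast
qed

subsection \<open>Cones of endomorphisms\<close>

lemma shift_dsum_suspension:
  assumes "is_dsum T A (sobj T A) B" shows "is_dsum T (shift T r A) (sobj T (shift T r A)) (shift T r B)"
proof -
  have A: "A \<in> obj T" using is_dsum_obj[OF assms] by blast
  have "isomorphic T (shift T r (shift T 1 A)) (sobj T (shift T r A))"
    using isomorphic_trans[OF shift_shift[OF A, of r 1] isomorphic_sym[OF shift_succ[OF A, of r]]] .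
  then show ?thesis
    using is_dsum_iso[OF is_dsum_shift_int[OF assms, of r] isomorphic_refl _ isomorphic_refl]
      shift_obj is_dsum_obj[OF assms] by simp
qed

text \<open>The sum of the triangles \<open>B \<rightarrow> 0 \<rightarrow> B[1]\<close> and \<open>0 \<rightarrow> B = B\<close> exhibits \<open>B \<oplus> B[1]\<close> as the cone of the
  zero endomorphism of \<open>B\<close>.\<close>

lemma dsum_shift_T0_Delta_nil:
  assumes "is_dsum T B (sobj T B) X" shows "X \<in> T0_Delta_nil T"
proof -
  note o = is_dsum_obj[OF assms]
  obtain Z where Z: "is_zero_obj T Z" using zero_obj_exists by blast
  have ZT: "Z \<in> obj T" using Z by (rule zero_obj_obj)
  obtain i j p q where b: "is_biproduct T B (sobj T B) X i j p q" using assms by (rule is_dsumE)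
  obtain g h where "dist_tri T B B X (hzero T Z B \<cdot> (hzero T B Z \<cdot> ident T B)
      \<boxplus> ident T B \<cdot> (hzero T Z B \<cdot> hzero T B Z)) g h"
    using dist_tri_sum[OF biproduct_zero_right[OF o(1) Z] biproduct_zero_left[OF o(1) Z]
        biproduct_commute[OF b] dist_tri_rotate[OF tri_ident[OF o(1) Z]]
        dist_tri_ident_left[OF o(1) Z]] by blast
  then have "dist_tri T B B X (ident T B \<cdot> hzero T B B \<boxplus> hzero T Z B \<cdot> hzero T B Z) g h"
    using o ZT by simp
  moreover have "hzero T B B \<in> hom_set T B B" "hzero T B Z \<in> hom_set T B Z"
    using o ZT by (simp_all add: hom_iff)
  ultimately have "degen_triangle T B (hzero T B B) Z X"
    unfolding degen_triangle_def using o ZT biproduct_zero_right[OF o(1) Z] by blast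
  moreover have "nilpotent_endo T B (hzero T B B)"
    unfolding nilpotent_endo_def using o by (auto simp: hom_iff intro!: exI[of _ 1])
  ultimately show ?thesis unfolding T0_Delta_nil_def le_Delta_nil_def using Z o by blast
qed

lemma T0_Delta_subset_T0: "T0_Delta T \<subseteq> T0 T"
  using le_Delta_T0 triangulated_subcategoryD(2)[OF triangulated_subcategory_T0]
  unfolding T0_Delta_def by blast

lemma extension_closure_subset:
  assumes D: "triangulated_subcategory T D" and "U \<subseteq> D" shows "extension_closure T U \<subseteq> D"
proof -
  have "star_power T U n \<subseteq> D" for n
  proof (induction n)
    case 0
    then show ?case using triangulated_subcategoryD(2)[OF D] by auto
  next
    case (Suc n)
    then show ?case using triangulated_subcategory_extension[OF D] assms(2) triangleI
      unfolding star_power.simps star_def by blast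
  qed
  then show ?thesis unfolding extension_closure_def by blast
qed


section \<open>Generators of the objects of class zero\<close>

text \<open>Oddness of the shifts puts the generators into \<open>T\<^sup>0\<close>. For the other inclusion, the objects
  \<open>S \<oplus> S[t\<^sub>S]\<close> generate a dense subcategory since each \<open>S\<close> is a direct summand of one of them.\<close>

lemma T0_eq_tria:
  assumes S: "S \<subseteq> obj T" "obj T = tria T S" and t: "\<And>A. A \<in> S \<Longrightarrow> odd (t A)"
  shows "T0 T = tria T {X. \<exists>A \<in> S. is_dsum T A (shift T (t A) A) X}" (is "_ = tria T ?U")
proof
  have U: "?U \<subseteq> obj T" using is_dsum_obj by blast
  note D = triangulated_subcategory_tria[OF U]
  show "tria T ?U \<subseteq> T0 T"
    by (rule tria_least[OF triangulated_subcategory_T0]) (use dsum_odd_shift_T0 t in blast)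
  have "S \<subseteq> {X. \<exists>X'. \<exists>W \<in> tria T ?U. is_dsum T X X' W}"
  proof
    fix A assume A: "A \<in> S"
    then obtain W where W: "is_dsum T A (shift T (t A) A) W"
      using dsum_exists[of A "shift T (t A) A"] S(1) shift_obj by blast
    then have "W \<in> tria T ?U" using A unfolding tria_def by blast
    then show "A \<in> {X. \<exists>X'. \<exists>W \<in> tria T ?U. is_dsum T X X' W}" using W by blast
  qed
  then have "obj T \<subseteq> {X. \<exists>X'. \<exists>W \<in> tria T ?U. is_dsum T X X' W}"
    using tria_least[OF summands_triangulated[OF D]] S(2) by blast
  then show "T0 T \<subseteq> tria T ?U" using T0_subset_dense[OF D] by blast
qed

context
  fixes S :: "'o set"
  assumes S: "S \<subseteq> obj T" "obj T = tria T S"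
begin

text \<open>These generate the objects of class zero, by the case \<open>t\<^sub>S = 1\<close> of \<open>T0_eq_tria\<close>.\<close>

definition doubles :: "'o set" where
  "doubles = {X. \<exists>A \<in> S. is_dsum T A (sobj T A) X}"

lemma doubles_obj: "doubles \<subseteq> obj T"
  using is_dsum_obj by (auto simp: doubles_def)

lemma T0_filtered:
  assumes "M \<in> T0 T" shows "M \<in> filtered T (shift_closure T doubles)"
proof -
  have "T0 T = tria T doubles"
    using T0_eq_tria[OF S, of "\<lambda>_. 1"] by (simp add: doubles_def)
  then show ?thesis using tria_subset_filtered[OF doubles_obj] assms by blast
qed

text \<open>A shift of \<open>A \<oplus> A[1]\<close> contributes the two summands \<open>A[r]\<close> and \<open>A[r+1]\<close>.\<close>

lemma doubles_shift_summands:
  assumes "N \<in> finite_dsums T (shifts T doubles)" shows "N \<in> finite_dsums T (shifts T S)"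
  using assms
proof (induction rule: finite_dsums.induct)
  case (zero N)
  then show ?case by (rule finite_dsums.zero)
next
  case (step X B W)
  then obtain r Y A where A: "A \<in> S" "is_dsum T A (sobj T A) Y" "X = shift T r Y"
    by (auto simp: shifts_def doubles_def)
  note o = is_dsum_obj[OF step.hyps(3)] is_dsum_obj[OF A(2)]
  have "is_dsum T (shift T r A) (shift T (r + 1) A) X"
    unfolding A(3)
    by (rule is_dsum_iso[OF shift_dsum_suspension[OF A(2)] isomorphic_refl shift_succ isomorphic_refl])
      (intro shift_obj o)+
  moreover obtain V where V: "is_dsum T (shift T (r + 1) A) B V"
    using dsum_exists[OF shift_obj[OF o(4)] o(2)] by blast
  ultimately have W: "is_dsum T (shift T r A) V W" using step.hyps(3) is_dsum_assoc by blast
  have "shift T r' A \<in> shifts T S" for r' using A(1) by (auto simp: shifts_def)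
  then show ?case using step.IH V W by (blast intro: finite_dsums.step)
qed

lemma T0_degeneration:
  assumes M: "M \<in> T0 T"
  shows "\<exists>X \<in> S_hat T S. X \<in> finite_dsums T (shifts T (S_bar T S)) \<and> le_Delta_nil T M X"
proof -
  obtain N where "N \<in> finite_dsums T (shift_closure T doubles)" and le: "le_Delta_nil T M N"
    using filtered_degeneration[OF T0_filtered[OF M]] by blast
  then have N: "N \<in> finite_dsums T (shifts T doubles)" by (intro finite_dsums_shift_closure)
  have "doubles \<subseteq> S_bar T S"
  proof
    fix X assume "X \<in> doubles"
    then obtain A where "A \<in> S" "is_dsum T A (shift T (2 * 0 + 1) A) X" by (auto simp: doubles_def)
    then show "X \<in> S_bar T S" unfolding S_bar_def by blast
  qed
  then have "N \<in> finite_dsums T (shifts T (S_bar T S))"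
    by (intro finite_dsums_mono[OF N]) (auto simp: shifts_def)
  moreover have "N \<in> S_hat T S"
    using doubles_shift_summands[OF N] le_Delta_T0[OF le_Delta_nil_imp[OF le]] M
    by (simp add: S_hat_def T0_def)
  ultimately show ?thesis using le by blast
qed

text \<open>The factors of a filtration by shifts of objects \<open>A \<oplus> A[1]\<close> are cones of zero endomorphisms.\<close>

lemma T0_subset_extension_closure: "T0 T \<subseteq> extension_closure T (T0_Delta_nil T)"
proof -
  have "shift_closure T doubles \<subseteq> T0_Delta_nil T"
  proof
    fix X assume "X \<in> shift_closure T doubles"
    then obtain A Y r where A: "A \<in> S" "is_dsum T A (sobj T A) Y" "isomorphic T X (shift T r Y)"
      by (auto simp: shift_closure_def doubles_def)
    have "is_dsum T (shift T r A) (sobj T (shift T r A)) X"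
      by (rule is_dsum_iso[OF shift_dsum_suspension[OF A(2)] isomorphic_refl isomorphic_refl
            isomorphic_sym[OF A(3)]]) (intro sobj_obj shift_obj is_dsum_obj[OF A(2)])+
    then show "X \<in> T0_Delta_nil T" by (rule dsum_shift_T0_Delta_nil)
  qed
  then show ?thesis
    using filtered_subset_extension_closure[OF filtered_mono[OF T0_filtered]] by blast
qed

end

end

theorem theorem21:
  fixes T :: "('o, 'm, 'z) tricat_scheme" and S :: "'o set"
  assumes "triangulated_category T"
    and "S \<subseteq> obj T"
    and "obj T = tria T S"
  shows
    "(\<forall>M \<in> obj T.
        (M \<in> T0 T \<longleftrightarrow> (\<exists>X \<in> S_hat T S. le_Delta T M X)) \<and>
        (M \<in> T0 T \<longleftrightarrow> (\<exists>X \<in> S_hat T S. prec_Delta_nil T M X)) \<and>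
        (is_Z_basis (K0 T) (K0_class T ` S) \<longrightarrow>
          (M \<in> T0 T \<longleftrightarrow>
            (\<exists>X \<in> S_hat T S. X \<in> finite_dsums T (shifts T (S_bar T S)) \<and> le_Delta T M X)) \<and>
          (M \<in> T0 T \<longleftrightarrow>
            (\<exists>X \<in> S_hat T S. X \<in> finite_dsums T (shifts T (S_bar T S)) \<and> prec_Delta_nil T M X))))
     \<and>
     (\<forall>t :: 'o \<Rightarrow> int. (\<forall>A \<in> S. odd (t A)) \<longrightarrow>
        T0 T = tria T {X. \<exists>A \<in> S. is_dsum T A (shift T (t A) A) X})
     \<and>
     T0 T = extension_closure T (T0_Delta T) \<and>
     T0 T = extension_closure T (T0_Delta_nil T)"
proof -
  interpret triangulated_category T by fact
  note S = assms(2,3)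
  have "S_hat T S \<subseteq> T0 T" using finite_dsums_obj by (auto simp: S_hat_def T0_def)
  then have le: "M \<in> T0 T" if "X \<in> S_hat T S" "le_Delta T M X" for M X
    using that le_Delta_T0 by blast
  have prec: "M \<in> T0 T" if "X \<in> S_hat T S" "prec_Delta_nil T M X" for M X
    using \<open>S_hat T S \<subseteq> T0 T\<close> that prec_Delta_nil_T0 by blast
  have ex: "\<exists>X \<in> S_hat T S. X \<in> finite_dsums T (shifts T (S_bar T S)) \<and>
      le_Delta T M X \<and> prec_Delta_nil T M X" if "M \<in> T0 T" for M
    using T0_degeneration[OF S that] le_Delta_nil_imp unfolding prec_Delta_nil_def by blast
  have E: "extension_closure T (T0_Delta_nil T) \<subseteq> extension_closure T (T0_Delta T)"
  proof -
    have "T0_Delta_nil T \<subseteq> T0_Delta T"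
      using le_Delta_nil_imp unfolding T0_Delta_def T0_Delta_nil_def by blast
    then show ?thesis using star_power_mono unfolding extension_closure_def by blast
  qed
  show ?thesis
  proof (intro conjI ballI allI impI)
    fix M
    show "M \<in> T0 T \<longleftrightarrow> (\<exists>X \<in> S_hat T S. le_Delta T M X)" using le ex by blast
    show "M \<in> T0 T \<longleftrightarrow> (\<exists>X \<in> S_hat T S. prec_Delta_nil T M X)" using prec ex by blast
    show "M \<in> T0 T \<longleftrightarrow>
        (\<exists>X \<in> S_hat T S. X \<in> finite_dsums T (shifts T (S_bar T S)) \<and> le_Delta T M X)"
      using le ex by blast
    show "M \<in> T0 T \<longleftrightarrow>
        (\<exists>X \<in> S_hat T S. X \<in> finite_dsums T (shifts T (S_bar T S)) \<and> prec_Delta_nil T M X)"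
      using prec ex by blast
  next
    fix t :: "'o \<Rightarrow> int" assume "\<forall>A \<in> S. odd (t A)"
    then show "T0 T = tria T {X. \<exists>A \<in> S. is_dsum T A (shift T (t A) A) X}"
      by (intro T0_eq_tria[OF S]) blast
  next
    note up = T0_subset_extension_closure[OF S]
    note down = extension_closure_subset[OF triangulated_subcategory_T0 T0_Delta_subset_T0]
    show "T0 T = extension_closure T (T0_Delta T)" using up down E by blast
    show "T0 T = extension_closure T (T0_Delta_nil T)" using up down E by blast
  qed
qed

end
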